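(* Let $X$ be a finite-dimensional Euclidean space, let $g\colon X\to\overline{\mathbb R}$ be lower semicontinuous, let $\hat v\in\partial g(\bar x)$, and assume that $g$ is prox-regular and subdifferentially continuous at $\bar x$ for $\hat v$, with threshold of prox-regularity $\mathcal R$. Define $$\tau_0:=\inf\Big\{\frac{\langle z,w\rangle}{\|w\|^2}\ \Big|\ z\in(D^*\partial g)(\bar x,\hat v)(w),\ w\ne0\Big\}$$ (with $\inf\emptyset=+\infty$). Then: (i) The number $\tau_0$ is well-defined, i.e. $\tau_0>-\infty$. (ii) $\mathcal R=\max\{0,-\tau_0\}$.
   Context: $\overline{\mathbb R}=(-\infty,\infty]$. For an extended-real-valued $\varphi$ with $\varphi(\bar x)<\infty$, $\hat\partial\varphi(\bar x)=\{v\mid\liminf_{x\to\bar x}\frac{\varphi(x)-\varphi(\bar x)-\langle v,x-\bar x\rangle}{\|x-\bar x\|}\ge0\}$; the limiting subdifferential $\partial\varphi(\bar x)$ is the set of all limits $v=\lim v_k$ with $v_k\in\hat\partial\varphi(x_k)$, $x_k\to\bar x$, $\varphi(x_k)\to\varphi(\bar x)$. The limiting normal cone is $N_\Omega(\bar x)=\partial\delta_\Omega(\bar x)$, with $\delta_\Omega$ the indicator function, and the limiting coderivative of $F\colon X\rightrightarrows X$ at $(x,y)\in\operatorname{gph}F$ is $D^*F(x,y)(w)=\{z\mid(z,-w)\in N_{\operatorname{gph}F}(x,y)\}$. $g$ is prox-regular at $\bar x$ for $\hat v$ if there are neighborhoods $U$ of $\bar x$, $V$ of $\hat v$ and $\varepsilon,r>0$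 with $g(x)\ge g(u)+\langle v,x-u\rangle-\frac r2\|x-u\|^2$ for all $x\in U$ whenever $v\in\partial g(u)\cap V$, $u\in U$, $g(u)\le g(\bar x)+\varepsilon$. The infimum of all $r>0$ for which this holds (with some $U,V,\varepsilon$) is the threshold of prox-regularity $\mathcal R$ of $g$ at $\bar x$ for $\hat v$. $g$ is subdifferentially continuous at $\bar x$ for $\hat v$ if $(x,v)\mapsto g(x)$ is continuous relative to $\operatorname{gph}\partial g$ at $(\bar x,\hat v)$. *)

theory Defs
  imports "HOL-Analysis.Analysis"
begin

text \<open>
  Functions into \<open>(-\<infinity>,\<infinity>]\<close> are rendered as \<open>ereal\<close>-valued functions; the exclusion of
  \<open>-\<infinity>\<close> is a hypothesis wherever it is needed.
\<close>

definition lower_semicontinuous :: "('a::topological_space \<Rightarrow> ereal) \<Rightarrow> bool" where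
  "lower_semicontinuous g \<longleftrightarrow> (\<forall>x. g x \<le> Liminf (at x) g)"

text \<open>Both subdifferentials are empty at points where the function is not finite.\<close>

definition frechet_subdifferential :: "('a::real_inner \<Rightarrow> ereal) \<Rightarrow> 'a \<Rightarrow> 'a set" where
  "frechet_subdifferential \<phi> x =
    {v. \<bar>\<phi> x\<bar> \<noteq> \<infinity> \<and>
        0 \<le> Liminf (at x)
              (\<lambda>y. (\<phi> y - \<phi> x - ereal (v \<bullet> (y - x))) / ereal (norm (y - x)))}"

definition limiting_subdifferential :: "('a::real_inner \<Rightarrow> ereal) \<Rightarrow> 'a \<Rightarrow> 'a set" where
  "limiting_subdifferential \<phi> x =
    {v. \<bar>\<phi> x\<bar> \<noteq> \<infinity> \<and>
        (\<exists>(xs :: nat \<Rightarrow> 'a) (vs :: nat \<Rightarrow> 'a).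
           (\<forall>k. vs k \<in> frechet_subdifferential \<phi> (xs k)) \<and>
           xs \<longlonglongrightarrow> x \<and> (\<lambda>k. \<phi> (xs k)) \<longlonglongrightarrow> \<phi> x \<and> vs \<longlonglongrightarrow> v)}"

definition indicator_fun :: "'a set \<Rightarrow> 'a \<Rightarrow> ereal" where
  "indicator_fun \<Omega> x = (if x \<in> \<Omega> then 0 else \<infinity>)"

definition limiting_normal_cone :: "'a::real_inner set \<Rightarrow> 'a \<Rightarrow> 'a set" where
  "limiting_normal_cone \<Omega> x = limiting_subdifferential (indicator_fun \<Omega>) x"

definition graph_of :: "('a \<Rightarrow> 'b set) \<Rightarrow> ('a \<times> 'b) set" where
  "graph_of F = {(x, y). y \<in> F x}"

text \<open>
  The product space carries the inner product
  \<open>(x, y) \<bullet> (z, w) = x \<bullet> z + y \<bullet> w\<close>.  Off the graph of \<open>F\<close> the normal cone,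
  hence the coderivative, is empty.
\<close>

definition limiting_coderivative ::
    "('a::real_inner \<Rightarrow> 'b::real_inner set) \<Rightarrow> 'a \<Rightarrow> 'b \<Rightarrow> 'b \<Rightarrow> 'a set" where
  "limiting_coderivative F x y w = {z. (z, - w) \<in> limiting_normal_cone (graph_of F) (x, y)}"

definition prox_regular_with :: "real \<Rightarrow> ('a::real_inner \<Rightarrow> ereal) \<Rightarrow> 'a \<Rightarrow> 'a \<Rightarrow> bool" where
  "prox_regular_with r g xbar vhat \<longleftrightarrow>
    (\<exists>U V \<epsilon>. open U \<and> xbar \<in> U \<and> open V \<and> vhat \<in> V \<and> 0 < (\<epsilon>::real) \<and>
      (\<forall>u v x. u \<in> U \<and> g u \<le> g xbar + ereal \<epsilon> \<and>
               v \<in> limiting_subdifferential g u \<inter> V \<and> x \<in> U \<longrightarrow>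
         g x \<ge> g u + ereal (v \<bullet> (x - u) - r / 2 * (norm (x - u))\<^sup>2)))"

definition prox_regular :: "('a::real_inner \<Rightarrow> ereal) \<Rightarrow> 'a \<Rightarrow> 'a \<Rightarrow> bool" where
  "prox_regular g xbar vhat \<longleftrightarrow> (\<exists>r>0. prox_regular_with r g xbar vhat)"

definition prox_regularity_threshold :: "('a::real_inner \<Rightarrow> ereal) \<Rightarrow> 'a \<Rightarrow> 'a \<Rightarrow> ereal" where
  "prox_regularity_threshold g xbar vhat =
    Inf {ereal r | r. 0 < r \<and> prox_regular_with r g xbar vhat}"

definition subdifferentially_continuous :: "('a::real_inner \<Rightarrow> ereal) \<Rightarrow> 'a \<Rightarrow> 'a \<Rightarrow> bool" where
  "subdifferentially_continuous g xbar vhat \<longleftrightarrow>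
    continuous (at (xbar, vhat) within graph_of (limiting_subdifferential g)) (\<lambda>(x, v). g x)"

text \<open>The infimum is taken in \<open>ereal\<close>, where \<open>Inf {} = \<infinity>\<close>.\<close>

definition tau0 :: "('a::real_inner \<Rightarrow> ereal) \<Rightarrow> 'a \<Rightarrow> 'a \<Rightarrow> ereal" where
  "tau0 g xbar vhat =
    Inf {ereal ((z \<bullet> w) / (norm w)\<^sup>2) | z w.
           z \<in> limiting_coderivative (limiting_subdifferential g) xbar vhat w \<and> w \<noteq> 0}"

end

theory Submission
  imports Defs
begin

text \<open>
  Let \<open>r\<close> be a constant of prox-regularity and choose \<open>\<mu> > 0\<close> with \<open>r * \<mu> < 1\<close>.  The proof
  transfers every question about the graph \<open>T\<close> of the limiting subdifferential near
  \<open>(xbar, vhat)\<close> to the proximal mapping \<open>P\<close>, where \<open>P q\<close> minimizes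
  \<open>g y + (norm (y - q))\<^sup>2 / (2 * \<mu>)\<close> over a small ball around \<open>xbar\<close>.  The prox-regularity
  inequality makes this objective grow quadratically around any \<open>u\<close> with
  \<open>q = u + \<mu> *\<^sub>R v\<close> and \<open>(u, v) \<in> T\<close>; hence \<open>P\<close> is Lipschitz near
  \<open>qbar = xbar + \<mu> *\<^sub>R vhat\<close>, and \<open>q \<mapsto> (P q, (q - P q) / \<mu>)\<close> is a bi-Lipschitz
  parametrization of \<open>T\<close> near \<open>(xbar, vhat)\<close> with inverse \<open>(u, v) \<mapsto> u + \<mu> *\<^sub>R v\<close>
  (\<open>prox_stability\<close>, \<open>prox_grad_near\<close>, \<open>prox_eq\<close>).

  Lower bound for the threshold.  If \<open>(z, - w)\<close> is a regular normal to \<open>T\<close> at a nearby point,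
  test it along the curve in \<open>T\<close> that is the image of a straight line under the parametrization.
  Since \<open>T\<close> is hypomonotone with modulus \<open>r\<close>, a suitable direction of the line gives
  \<open>z \<bullet> w \<ge> - r * (norm w)\<^sup>2\<close> (\<open>frechet_normal_lower_bound\<close>).  This inequality passes to
  limiting normals, so \<open>\<tau>\<^sub>0 \<ge> - r\<close> (\<open>tau0_lower_bound\<close>).  In particular \<open>\<tau>\<^sub>0 > -\<infinity>\<close>.

  Upper bound.  Let \<open>s > 0\<close>, \<open>s > - \<tau>\<^sub>0\<close> and \<open>s * \<mu> < 1\<close>.  Then
  \<open>(P a - P b) \<bullet> (a - b) \<le> L * (norm (a - b))\<^sup>2\<close> near \<open>qbar\<close> with \<open>L = 1 / (1 - s * \<mu>)\<close>
  (\<open>tau0_controls_prox_expansion\<close>).  Otherwise pairs \<open>a, b\<close> arbitrarily close to \<open>qbar\<close>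
  violate this, and a mean value inequality for the Lipschitz function \<open>d \<bullet> P\<close>,
  where \<open>d\<close> is the unit vector along \<open>a - b\<close>, produces a proximal subgradient \<open>x\<close>
  with \<open>x \<bullet> d \<ge> L\<close>, that is, a regular normal \<open>(x - d, \<mu> *\<^sub>R x)\<close> to \<open>T\<close>.
  The bound \<open>x \<bullet> d \<ge> L\<close> keeps \<open>x\<close> away from \<open>0\<close>, so that the limit of these normals competes
  in the infimum \<open>\<tau>\<^sub>0\<close>; it forces \<open>\<tau>\<^sub>0 \<le> - s\<close>, a contradiction.
  Finally \<open>(q - P q) / \<mu>\<close> is the gradient of the Moreau envelope of \<open>g\<close>.  Integrating the
  expansion bound along segments yields a quadratic lower bound for the envelope, and this bound,
  tested at the best point, is exactly the prox-regularity inequality with constant \<open>s\<close>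
  (\<open>prox_expansion_imp_prox_inequality\<close>).
\<close>

section \<open>Regular subgradients and normals\<close>

lemma difference_quotient_bound_iff:
  fixes A B :: ereal
  assumes "\<bar>A\<bar> \<noteq> \<infinity>" and "0 < n"
  shows "ereal (- e) \<le> (B - A - ereal a) / ereal n \<longleftrightarrow> A + ereal (a - e * n) \<le> B"
  using assms by (cases A; cases B) (auto simp: field_simps divide_ereal_def)

lemma frechet_subdifferential_iff:
  fixes \<phi> :: "'a::real_inner \<Rightarrow> ereal"
  shows "v \<in> frechet_subdifferential \<phi> x \<longleftrightarrow>
    \<bar>\<phi> x\<bar> \<noteq> \<infinity> \<and>
    (\<forall>e>0. \<forall>\<^sub>F y in at x. \<phi> x + ereal (v \<bullet> (y - x) - e * norm (y - x)) \<le> \<phi> y)"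
proof (cases "\<bar>\<phi> x\<bar> = \<infinity>")
  case True
  then show ?thesis by (simp add: frechet_subdifferential_def)
next
  case fin: False
  let ?q = "\<lambda>y. (\<phi> y - \<phi> x - ereal (v \<bullet> (y - x))) / ereal (norm (y - x))"
  have quot: "ereal (- e) \<le> ?q y \<longleftrightarrow> \<phi> x + ereal (v \<bullet> (y - x) - e * norm (y - x)) \<le> \<phi> y"
    if "y \<noteq> x" for e y
    using that fin by (intro difference_quotient_bound_iff) auto
  have "0 \<le> Liminf (at x) ?q \<longleftrightarrow> (\<forall>e>0. \<forall>\<^sub>F y in at x. ereal (- e) \<le> ?q y)"
  proof
    assume "0 \<le> Liminf (at x) ?q"
    then show "\<forall>e>0. \<forall>\<^sub>F y in at x. ereal (- e) \<le> ?q y"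
      unfolding le_Liminf_iff
      by (metis (mono_tags, lifting) ereal_less(1) eventually_mono less_imp_le neg_less_0_iff_less)
  next
    assume ev: "\<forall>e>0. \<forall>\<^sub>F y in at x. ereal (- e) \<le> ?q y"
    show "0 \<le> Liminf (at x) ?q"
      unfolding le_Liminf_iff
    proof (intro allI impI)
      fix c :: ereal
      assume "c < 0"
      then obtain d where d: "c < ereal d" "ereal d < 0"
        using ereal_dense2 by blast
      then have "\<forall>\<^sub>F y in at x. ereal (- (- d)) \<le> ?q y"
        using ev by (auto simp del: minus_minus)
      then show "\<forall>\<^sub>F y in at x. c < ?q y"
        by (rule eventually_mono) (use d in \<open>auto intro: less_le_trans\<close>)
    qed
  qed
  also have "\<dots> \<longleftrightarrow>
      (\<forall>e>0. \<forall>\<^sub>F y in at x. \<phi> x + ereal (v \<bullet> (y - x) - e * norm (y - x)) \<le> \<phi> y)"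
    by (simp add: eventually_at_filter quot cong: imp_cong)
  finally show ?thesis
    using fin by (simp add: frechet_subdifferential_def)
qed

text \<open>Regular normals in their familiar form: the difference quotient of an indicator function
  only matters along the set itself.\<close>

lemma frechet_normal_iff:
  fixes \<Omega> :: "'a::real_inner set"
  shows "n \<in> frechet_subdifferential (indicator_fun \<Omega>) p \<longleftrightarrow>
    p \<in> \<Omega> \<and> (\<forall>e>0. \<forall>\<^sub>F y in at p. y \<in> \<Omega> \<longrightarrow> n \<bullet> (y - p) \<le> e * norm (y - p))"
proof (cases "p \<in> \<Omega>")
  case True
  then have "indicator_fun \<Omega> p + ereal (n \<bullet> (y - p) - e * norm (y - p)) \<le> indicator_fun \<Omega> y
      \<longleftrightarrow> (y \<in> \<Omega> \<longrightarrow> n \<bullet> (y - p) \<le> e * norm (y - p))" for y e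
    by (auto simp: indicator_fun_def zero_ereal_def)
  then show ?thesis
    using True by (simp add: frechet_subdifferential_iff) (simp add: indicator_fun_def)
qed (simp add: frechet_subdifferential_def indicator_fun_def)

lemma eventually_quadratic_le_linear:
  fixes x :: "'a::real_normed_vector"
  assumes "0 < e"
  shows "\<forall>\<^sub>F y in at x. C * (norm (y - x))\<^sup>2 \<le> e * norm (y - x)"
proof -
  have "((\<lambda>y. C * norm (y - x)) \<longlongrightarrow> C * norm (x - x)) (at x)"
    by (intro tendsto_intros)
  then have "\<forall>\<^sub>F y in at x. C * norm (y - x) < e"
    using assms by (intro order_tendstoD) auto
  then show ?thesis
    by (rule eventually_mono) (simp add: power2_eq_square mult_right_mono flip: mult.assoc)
qed

text \<open>Proximal subgradients are regular: a quadratic error is eventually smaller than any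
  linear one.\<close>

lemma proximal_imp_frechet_subgradient:
  fixes \<phi> :: "'a::real_inner \<Rightarrow> ereal"
  assumes fin: "\<bar>\<phi> x\<bar> \<noteq> \<infinity>"
    and "\<forall>\<^sub>F y in at x. \<phi> x + ereal (v \<bullet> (y - x) - C * (norm (y - x))\<^sup>2) \<le> \<phi> y"
  shows "v \<in> frechet_subdifferential \<phi> x"
  unfolding frechet_subdifferential_iff
proof (intro conjI allI impI fin)
  fix e :: real
  assume "0 < e"
  show "\<forall>\<^sub>F y in at x. \<phi> x + ereal (v \<bullet> (y - x) - e * norm (y - x)) \<le> \<phi> y"
    using assms(2) eventually_quadratic_le_linear[OF \<open>0 < e\<close>, where x = x and C = C]
  proof eventually_elim
    case (elim y)
    have "\<phi> x + ereal (v \<bullet> (y - x) - e * norm (y - x))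
        \<le> \<phi> x + ereal (v \<bullet> (y - x) - C * (norm (y - x))\<^sup>2)"
      using elim(2) by (intro add_left_mono) auto
    with elim(1) show ?case by (rule order_trans[rotated])
  qed
qed

lemma proximal_imp_frechet_normal:
  fixes \<Omega> :: "'a::real_inner set"
  assumes "p \<in> \<Omega>" and "\<forall>\<^sub>F y in at p. y \<in> \<Omega> \<longrightarrow> n \<bullet> (y - p) \<le> C * (norm (y - p))\<^sup>2"
  shows "n \<in> frechet_subdifferential (indicator_fun \<Omega>) p"
proof (rule proximal_imp_frechet_subgradient[where C = C])
  show "\<forall>\<^sub>F y in at p. indicator_fun \<Omega> p + ereal (n \<bullet> (y - p) - C * (norm (y - p))\<^sup>2)
      \<le> indicator_fun \<Omega> y"
    using assms(2) by (rule eventually_mono)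
      (use assms(1) in \<open>auto simp: indicator_fun_def zero_ereal_def\<close>)
qed (use assms(1) in \<open>simp add: indicator_fun_def\<close>)

lemma frechet_imp_limiting:
  "v \<in> frechet_subdifferential \<phi> x \<Longrightarrow> v \<in> limiting_subdifferential \<phi> x"
proof -
  assume v: "v \<in> frechet_subdifferential \<phi> x"
  then have "\<bar>\<phi> x\<bar> \<noteq> \<infinity>"
    by (simp add: frechet_subdifferential_def)
  with v show ?thesis
    unfolding limiting_subdifferential_def
    by (intro CollectI conjI exI[where x = "\<lambda>_. x"] exI[where x = "\<lambda>_. v"]) auto
qed

lemma limiting_subdifferential_finite:
  "v \<in> limiting_subdifferential \<phi> x \<Longrightarrow> \<bar>\<phi> x\<bar> \<noteq> \<infinity>"
  by (simp add: limiting_subdifferential_def)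

text \<open>Convergence of the function values is automatic for an indicator function, because
  regular normals exist only at points of the set.\<close>

lemma limiting_normal_iff:
  fixes \<Omega> :: "'a::real_inner set"
  shows "n \<in> limiting_normal_cone \<Omega> p \<longleftrightarrow> p \<in> \<Omega> \<and>
    (\<exists>ps ns. (\<forall>k. ns k \<in> frechet_subdifferential (indicator_fun \<Omega>) (ps k)) \<and>
       ps \<longlonglongrightarrow> p \<and> ns \<longlonglongrightarrow> n)" (is "_ \<longleftrightarrow> _ \<and> ?R")
proof -
  have lim: "(\<lambda>k. indicator_fun \<Omega> (ps k)) \<longlonglongrightarrow> indicator_fun \<Omega> p"
    if "p \<in> \<Omega>" "\<And>k. ns k \<in> frechet_subdifferential (indicator_fun \<Omega>) (ps k)" for ps ns
  proof -
    have "ps k \<in> \<Omega>" for k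
      using that(2)[of k] by (simp add: frechet_normal_iff)
    then show ?thesis
      using that(1) by (simp add: indicator_fun_def)
  qed
  have "\<bar>indicator_fun \<Omega> p\<bar> \<noteq> \<infinity> \<longleftrightarrow> p \<in> \<Omega>"
    by (simp add: indicator_fun_def)
  with lim show ?thesis
    unfolding limiting_normal_cone_def limiting_subdifferential_def mem_Collect_eq by metis
qed

section \<open>Attainment and a one-sided mean value inequality\<close>

text \<open>A minimizing sequence has a convergent subsequence; lower semicontinuity passes to its
  limit.  The continuous summand is kept separate since the proximal objective is a sum of this
  kind.\<close>

lemma lower_semicontinuous_attains_min:
  fixes g :: "'a::metric_space \<Rightarrow> ereal" and k :: "'a \<Rightarrow> real"
  assumes lsc: "lower_semicontinuous g"
    and k: "continuous_on UNIV k"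
    and B: "compact B" "B \<noteq> {}"
  shows "\<exists>u\<in>B. \<forall>y\<in>B. g u + ereal (k u) \<le> g y + ereal (k y)"
proof -
  let ?H = "\<lambda>y. g y + ereal (k y)"
  define m where "m = Inf (?H ` B)"
  obtain h where h: "\<And>n. h n \<in> ?H ` B" "h \<longlonglongrightarrow> m"
    using Inf_as_limit[of "?H ` B"] B by (auto simp: m_def)
  then obtain y where y: "\<And>n. y n \<in> B" "\<And>n. h n = ?H (y n)"
    unfolding image_iff by metis
  obtain u \<sigma> where u: "u \<in> B" "strict_mono \<sigma>" "(y \<circ> \<sigma>) \<longlonglongrightarrow> u"
    using B(1) y(1) unfolding compact_def by metis
  have hs: "(\<lambda>n. h (\<sigma> n)) \<longlonglongrightarrow> m"
    using LIMSEQ_subseq_LIMSEQ[OF h(2) u(2)] by (simp add: o_def)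
  have ks: "(\<lambda>n. ereal (k (y (\<sigma> n)))) \<longlonglongrightarrow> ereal (k u)"
    using u(3) continuous_on_tendsto_compose[OF k, of "y \<circ> \<sigma>" u] by (simp add: o_def)
  have "(\<lambda>n. h (\<sigma> n) - ereal (k (y (\<sigma> n)))) \<longlonglongrightarrow> m - ereal (k u)"
    by (rule tendsto_diff_ereal_general[OF hs ks]) auto
  moreover have "h (\<sigma> n) - ereal (k (y (\<sigma> n))) = g (y (\<sigma> n))" for n
    by (cases "g (y (\<sigma> n))") (auto simp: y(2))
  ultimately have gs: "(\<lambda>n. g (y (\<sigma> n))) \<longlonglongrightarrow> m - ereal (k u)"
    by simp
  have "g u \<le> m - ereal (k u)"
  proof (rule ccontr)
    assume "\<not> ?thesis"
    then obtain c where c: "m - ereal (k u) < c" "c < g u"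
      using dense[of "m - ereal (k u)" "g u"] by (auto simp: not_le)
    have "c < Liminf (at u) g"
      using lsc c(2) by (auto simp: lower_semicontinuous_def intro: less_le_trans)
    then have "\<forall>\<^sub>F z in at u. c < g z"
      by (rule less_LiminfD)
    then have "\<forall>\<^sub>F z in nhds u. c < g z"
      using c(2) by (auto simp: eventually_at_filter elim: eventually_mono)
    then have "\<forall>\<^sub>F n in sequentially. c < g (y (\<sigma> n))"
      using u(3) by (auto simp: filterlim_iff o_def)
    then have "c \<le> m - ereal (k u)"
      by (intro tendsto_lowerbound[OF gs]) (auto elim: eventually_mono)
    with c(1) show False by simp
  qed
  then have "?H u \<le> m"
    by (cases "g u"; cases m) auto
  then have "\<forall>y\<in>B. ?H u \<le> ?H y"
    unfolding m_def by (auto intro: order_trans INF_lower)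
  with u(1) show ?thesis by blast
qed

text \<open>
  A nonsmooth mean value inequality: a Lipschitz function that increases from \<open>b\<close> to \<open>a\<close> has,
  near the segment, a proximal subgradient pointing weakly in the direction of increase.  Minimize
  \<open>F y + N * (norm (y - c))\<^sup>2\<close> over \<open>y\<close> in a ball and \<open>c\<close> in the segment.
  For large \<open>N\<close> the minimizing \<open>y\<close> is interior, so
  \<open>- 2 * N * (y - c)\<close> is a proximal subgradient, and \<open>c \<noteq> a\<close> because \<open>F b < F a\<close>; as \<open>c\<close>
  can still be moved towards \<open>a\<close>, its optimality gives the sign of the inner product.
\<close>

lemma lipschitz_ascent_subgradient:
  fixes F :: "'a::euclidean_space \<Rightarrow> real"
  assumes lip: "\<And>x y. x \<in> cball b (2 * norm (a - b)) \<Longrightarrow> y \<in> cball b (2 * norm (a - b)) \<Longrightarrow>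
      \<bar>F x - F y\<bar> \<le> K * norm (x - y)"
    and less: "F b < F a"
  shows "\<exists>q x C. norm (q - b) \<le> 2 * norm (a - b) \<and> 0 \<le> x \<bullet> (a - b) \<and>
    (\<forall>\<^sub>F y in nhds q. F q + x \<bullet> (y - q) - C * (norm (y - q))\<^sup>2 \<le> F y)"
proof -
  define l where "l = norm (a - b)"
  have l: "0 < l" using less by (auto simp: l_def)
  define S where "S = cball b (2 * l)"
  \<comment> \<open>Large enough that, at the minimum, \<open>c \<noteq> a\<close> (second summand) and \<open>y\<close> lies in the interior
    of the ball (first summand).\<close>
  define N where "N = (\<bar>K\<bar> + 1) * 4 / l + (K\<^sup>2 + 1) / (F a - F b)"
  have N: "0 < N" "2 * K / l < N" "K\<^sup>2 < 4 * N * (F a - F b)"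
  proof -
    have A: "0 < (\<bar>K\<bar> + 1) * 4 / l" "2 * K / l < (\<bar>K\<bar> + 1) * 4 / l"
      using l by (auto simp: divide_simps)
    have B: "0 < (K\<^sup>2 + 1) / (F a - F b)"
      using less by (auto intro!: divide_pos_pos add_nonneg_pos)
    show "0 < N" "2 * K / l < N"
      using A B by (auto simp: N_def)
    have "K\<^sup>2 < (K\<^sup>2 + 1) / (F a - F b) * (F a - F b)"
      using less by simp
    also have "\<dots> \<le> N * (F a - F b)"
      using A less unfolding N_def by (intro mult_right_mono) auto
    also have "\<dots> \<le> 4 * N * (F a - F b)"
      using \<open>0 < N\<close> less by auto
    finally show "K\<^sup>2 < 4 * N * (F a - F b)" .
  qed
  have contF: "continuous_on S F"
  proof (rule continuous_onI)
    fix x e assume "x \<in> S" and e: "(0::real) < e"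
    show "\<exists>d>0. \<forall>x'\<in>S. dist x' x < d \<longrightarrow> dist (F x') (F x) \<le> e"
    proof (intro exI[where x = "e / (\<bar>K\<bar> + 1)"] conjI ballI impI)
      show "0 < e / (\<bar>K\<bar> + 1)" using e by (auto intro!: divide_pos_pos)
      fix x' assume x': "x' \<in> S" "dist x' x < e / (\<bar>K\<bar> + 1)"
      have "dist (F x') (F x) \<le> K * norm (x' - x)"
        using lip[of x' x] x' \<open>x \<in> S\<close> by (simp add: S_def l_def dist_real_def)
      also have "\<dots> \<le> (\<bar>K\<bar> + 1) * norm (x' - x)"
        by (intro mult_right_mono) auto
      also have "\<dots> \<le> e"
        using x'(2) by (simp add: dist_norm pos_less_divide_eq mult.commute)
      finally show "dist (F x') (F x) \<le> e" .
    qed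
  qed
  define H where "H = (\<lambda>(y, c). F y + N * (norm (y - c))\<^sup>2)"
  have "continuous_on (S \<times> closed_segment b a) H"
    unfolding H_def case_prod_beta
    by (intro continuous_intros continuous_on_compose2[OF contF]) auto
  moreover have "compact (S \<times> closed_segment b a)"
    by (intro compact_Times) (auto simp: S_def)
  moreover have "(b, b) \<in> S \<times> closed_segment b a"
    using l by (auto simp: S_def)
  ultimately obtain qc where qc: "qc \<in> S \<times> closed_segment b a"
    "\<And>yc. yc \<in> S \<times> closed_segment b a \<Longrightarrow> H qc \<le> H yc"
    using continuous_attains_inf[of "S \<times> closed_segment b a" H] by blast
  obtain q c where [simp]: "qc = (q, c)" by force
  have q: "q \<in> S" and c: "c \<in> closed_segment b a"
    and min: "\<And>y e. y \<in> S \<Longrightarrow> e \<in> closed_segment b a \<Longrightarrow>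
      F q + N * (norm (q - c))\<^sup>2 \<le> F y + N * (norm (y - e))\<^sup>2"
    using qc by (auto simp: H_def)
  have bS: "b \<in> S" and aS: "a \<in> S"
    using l by (auto simp: S_def l_def dist_norm norm_minus_commute)
  have min_b: "F q + N * (norm (q - c))\<^sup>2 \<le> F b"
    using min[OF bS, of b] by simp
  have lipS: "\<bar>F x - F y\<bar> \<le> K * norm (x - y)" if "x \<in> S" "y \<in> S" for x y
    using lip that by (simp add: S_def l_def)
  have "c \<noteq> a"
  proof
    assume "c = a"
    let ?p = "norm (q - a)"
    have "F a - K * ?p \<le> F q"
      using lipS[OF q aS] by auto
    then have "F a - F b \<le> K * ?p - N * ?p\<^sup>2"
      using min_b \<open>c = a\<close> by simp
    then have "4 * N * (F a - F b) \<le> 4 * N * (K * ?p - N * ?p\<^sup>2)"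
      using N by simp
    also have "\<dots> = K\<^sup>2 - (K - 2 * N * ?p)\<^sup>2"
      by (simp add: power2_eq_square algebra_simps)
    also have "\<dots> \<le> K\<^sup>2" by simp
    finally show False using N by simp
  qed
  have q_int: "norm (q - b) < 2 * l"
  proof (rule ccontr)
    assume "\<not> ?thesis"
    then have qb: "norm (q - b) = 2 * l"
      using q by (simp add: S_def dist_norm norm_minus_commute)
    have "norm (c - b) \<le> l"
      using c segment_bound1[of c b a] by (simp add: l_def norm_minus_commute)
    then have "l \<le> norm (q - c)"
      using qb norm_triangle_ineq[of "q - c" "c - b"] by simp
    then have "N * l\<^sup>2 \<le> N * (norm (q - c))\<^sup>2"
      using N l by (intro mult_left_mono power_mono) auto
    moreover have "F b - F q \<le> K * (2 * l)"
      using lipS[OF q bS] qb by simp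
    ultimately have "N * l\<^sup>2 \<le> K * 2 * l"
      using min_b by simp
    then have "N \<le> 2 * K / l"
      using l by (simp add: power2_eq_square field_simps)
    then show False using N by simp
  qed
  obtain t where t: "c = b + t *\<^sub>R (a - b)" "0 \<le> t" "t \<le> 1"
    using c by (auto simp: in_segment algebra_simps)
  have "t < 1"
    using t \<open>c \<noteq> a\<close> by (cases "t = 1") auto
  have desc: "(q - c) \<bullet> (a - b) \<le> 0"
  proof (rule ccontr)
    assume "\<not> ?thesis"
    then have pos: "0 < (q - c) \<bullet> (a - b)" by simp
    \<comment> \<open>Moving \<open>c\<close> by the fraction \<open>h\<close> of the segment stays in the segment, and \<open>h\<close> is so small
      that the linear gain exceeds the quadratic loss.\<close>
    define h where "h = min (1 - t) ((q - c) \<bullet> (a - b) / l\<^sup>2)"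
    have h: "0 < h" "h \<le> 1 - t" "h * l\<^sup>2 \<le> (q - c) \<bullet> (a - b)"
    proof -
      show "0 < h" "h \<le> 1 - t"
        using \<open>t < 1\<close> pos l by (auto simp: h_def)
      have "h * l\<^sup>2 \<le> (q - c) \<bullet> (a - b) / l\<^sup>2 * l\<^sup>2"
        by (intro mult_right_mono) (auto simp: h_def)
      then show "h * l\<^sup>2 \<le> (q - c) \<bullet> (a - b)"
        using l by simp
    qed
    let ?e = "c + h *\<^sub>R (a - b)"
    have "?e = b + (t + h) *\<^sub>R (a - b)"
      by (simp add: t(1) algebra_simps)
    then have "?e \<in> closed_segment b a"
      unfolding in_segment using h t by (intro exI[where x = "t + h"]) (auto simp: algebra_simps)
    then have "(norm (q - c))\<^sup>2 \<le> (norm (q - ?e))\<^sup>2"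
      using min[OF q, of ?e] N by simp
    also have "(norm (q - ?e))\<^sup>2 = (norm (q - c))\<^sup>2 - 2 * h * ((q - c) \<bullet> (a - b)) + h * (h * l\<^sup>2)"
      unfolding l_def by (simp only: power2_norm_eq_inner) (simp add: algebra_simps inner_commute)
    finally have "2 * h * ((q - c) \<bullet> (a - b)) \<le> h * (h * l\<^sup>2)" by simp
    also have "\<dots> \<le> h * ((q - c) \<bullet> (a - b))"
      using h by (intro mult_left_mono) auto
    finally show False using h pos by (simp add: mult_less_0_iff)
  qed
  have "\<forall>\<^sub>F y in nhds q. F q + (- (2 * N) *\<^sub>R (q - c)) \<bullet> (y - q) - N * (norm (y - q))\<^sup>2 \<le> F y"
  proof -
    have "\<forall>\<^sub>F y in nhds q. y \<in> ball b (2 * l)"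
      using q_int by (intro eventually_nhds_in_open) (auto simp: dist_norm norm_minus_commute)
    then show ?thesis
    proof eventually_elim
      case (elim y)
      then have "y \<in> S" by (simp add: S_def)
      have "(norm (y - c))\<^sup>2 = (norm (q - c))\<^sup>2 + 2 * ((q - c) \<bullet> (y - q)) + (norm (y - q))\<^sup>2"
        by (simp only: power2_norm_eq_inner) (simp add: algebra_simps inner_commute)
      then have "N * (norm (y - c))\<^sup>2
          = N * (norm (q - c))\<^sup>2 + 2 * N * ((q - c) \<bullet> (y - q)) + N * (norm (y - q))\<^sup>2"
        by (simp only: distrib_left mult.assoc mult.left_commute[of N 2])
      then show ?case
        using min[OF \<open>y \<in> S\<close> c] by simp
    qed
  qed
  moreover have "0 \<le> (- (2 * N) *\<^sub>R (q - c)) \<bullet> (a - b)"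
    using desc N by (simp add: mult_nonneg_nonpos)
  ultimately show ?thesis
    using q_int unfolding l_def by (meson less_imp_le)
qed


lemma has_real_derivative_of_quadratic_error:
  fixes f :: "real \<Rightarrow> real"
  assumes "\<forall>\<^sub>F s in at t. \<bar>f s - f t - D * (s - t)\<bar> \<le> C * (s - t)\<^sup>2"
  shows "(f has_real_derivative D) (at t)"
  unfolding has_field_derivative_iff
proof (rule LIM_zero_cancel, rule Lim_null_comparison)
  have "\<forall>\<^sub>F s in at t. s \<noteq> t"
    by (simp add: eventually_at_filter)
  with assms show "\<forall>\<^sub>F s in at t. norm ((f s - f t) / (s - t) - D) \<le> C * \<bar>s - t\<bar>"
  proof eventually_elim
    case (elim s)
    have "(f s - f t) / (s - t) - D = (f s - f t - D * (s - t)) / (s - t)"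
      using elim by (simp add: field_simps)
    then have "norm ((f s - f t) / (s - t) - D) = \<bar>f s - f t - D * (s - t)\<bar> / \<bar>s - t\<bar>"
      by simp
    also have "\<dots> \<le> C * (s - t)\<^sup>2 / \<bar>s - t\<bar>"
      using elim by (intro divide_right_mono) auto
    also have "C * (s - t)\<^sup>2 = (C * \<bar>s - t\<bar>) * \<bar>s - t\<bar>"
      by (simp add: power2_eq_square mult.assoc)
    also have "\<dots> / \<bar>s - t\<bar> = C * \<bar>s - t\<bar>"
      using elim by (intro nonzero_mult_div_cancel_right) simp
    finally show ?case .
  qed
  have "((\<lambda>s. C * \<bar>s - t\<bar>) \<longlongrightarrow> C * \<bar>t - t\<bar>) (at t)"
    by (intro tendsto_intros)
  then show "((\<lambda>s. C * \<bar>s - t\<bar>) \<longlongrightarrow> 0) (at t)" by simp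
qed

section \<open>The proximal mapping\<close>

text \<open>Prox-regularity on balls, without the localization in function values: subdifferential
  continuity bounds these values on the graph.\<close>

definition prox_inequality_near ::
    "real \<Rightarrow> real \<Rightarrow> ('a::real_inner \<Rightarrow> ereal) \<Rightarrow> 'a \<Rightarrow> 'a \<Rightarrow> bool" where
  "prox_inequality_near r \<rho> g xbar vhat \<longleftrightarrow>
    (\<forall>u v x. u \<in> cball xbar \<rho> \<longrightarrow> v \<in> limiting_subdifferential g u \<longrightarrow> v \<in> cball vhat \<rho> \<longrightarrow>
       x \<in> cball xbar \<rho> \<longrightarrow> g u + ereal (v \<bullet> (x - u) - r / 2 * (norm (x - u))\<^sup>2) \<le> g x)"

text \<open>The constant \<open>\<mu>\<close> is the proximal parameter; \<open>r * \<mu> < 1\<close> makes the proximal objective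
  grow quadratically around the points of the subdifferential graph.\<close>

locale proximal_localization =
  fixes g :: "'a::euclidean_space \<Rightarrow> ereal" and xbar vhat :: 'a and r \<mu> \<rho> :: real
  assumes not_MInf: "\<And>x. g x \<noteq> -\<infinity>"
    and lsc: "lower_semicontinuous g"
    and base: "vhat \<in> limiting_subdifferential g xbar"
    and r: "0 < r" and \<mu>: "0 < \<mu>" and r\<mu>: "r * \<mu> < 1" and \<rho>: "0 < \<rho>"
    and ineq: "prox_inequality_near r \<rho> g xbar vhat"
begin

abbreviation T :: "('a \<times> 'a) set" where "T \<equiv> graph_of (limiting_subdifferential g)"

definition c :: real where "c = 1 - r * \<mu>"

definition qbar :: 'a where "qbar = xbar + \<mu> *\<^sub>R vhat"

text \<open>The minimization is restricted to a ball, since \<open>g\<close> may be unbounded below.\<close>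

definition prox :: "'a \<Rightarrow> 'a" where
  "prox q = (SOME u. u \<in> cball xbar \<rho> \<and> (\<forall>y\<in>cball xbar \<rho>.
     g u + ereal ((norm (u - q))\<^sup>2 / (2 * \<mu>)) \<le> g y + ereal ((norm (y - q))\<^sup>2 / (2 * \<mu>))))"

text \<open>The gradient of the Moreau envelope; it is the subgradient of \<open>g\<close> at \<open>prox q\<close> that
  optimality of \<open>prox q\<close> provides.\<close>

definition grad :: "'a \<Rightarrow> 'a" where "grad q = (1 / \<mu>) *\<^sub>R (q - prox q)"

definition val :: "'a \<Rightarrow> real" where "val x = real_of_ereal (g x)"

text \<open>On the ball of this radius around \<open>qbar\<close> the Lipschitz bounds \<open>2 / c\<close> and \<open>3 / (c * \<mu>)\<close>
  keep \<open>prox\<close> and \<open>grad\<close> within \<open>\<rho>\<close> of \<open>xbar\<close> and \<open>vhat\<close>.\<close>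

definition \<delta> :: real where "\<delta> = c * \<rho> * min 1 \<mu> / 4"

lemma c: "0 < c" "c < 1"
  using r\<mu> r \<mu> by (auto simp: c_def)

lemma \<delta>: "0 < \<delta>" "\<delta> \<le> c * \<rho> / 4" "\<delta> \<le> c * \<mu> * \<rho> / 4"
proof -
  have "c * \<rho> * min 1 \<mu> \<le> c * \<rho> * 1" "c * \<rho> * min 1 \<mu> \<le> c * \<rho> * \<mu>"
    using c \<rho> by (auto intro!: mult_left_mono)
  then show "0 < \<delta>" "\<delta> \<le> c * \<rho> / 4" "\<delta> \<le> c * \<mu> * \<rho> / 4"
    using c \<rho> \<mu> by (auto simp: \<delta>_def)
qed

lemma in_T [simp]: "(u, v) \<in> T \<longleftrightarrow> v \<in> limiting_subdifferential g u"
  by (simp add: graph_of_def)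

lemma T_finite: "(u, v) \<in> T \<Longrightarrow> \<bar>g u\<bar> \<noteq> \<infinity>"
  by (metis in_T limiting_subdifferential_finite)

lemma val: "\<bar>g x\<bar> \<noteq> \<infinity> \<Longrightarrow> g x = ereal (val x)"
  by (simp add: val_def ereal_real)

lemma ineq_real:
  assumes "(u, v) \<in> T" "u \<in> cball xbar \<rho>" "v \<in> cball vhat \<rho>" "x \<in> cball xbar \<rho>" "\<bar>g x\<bar> \<noteq> \<infinity>"
  shows "val u + v \<bullet> (x - u) - r / 2 * (norm (x - u))\<^sup>2 \<le> val x"
proof -
  have "\<bar>g u\<bar> \<noteq> \<infinity>"
    using assms(1) by (rule T_finite)
  then show ?thesis
    using ineq assms(1-4) val[of u] val[OF assms(5)]
    unfolding prox_inequality_near_def in_T by (metis ereal_less_eq(3) plus_ereal.simps(1) add_diff_eq)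
qed

lemma prox_minimizes:
  "prox q \<in> cball xbar \<rho>"
  "y \<in> cball xbar \<rho> \<Longrightarrow>
    g (prox q) + ereal ((norm (prox q - q))\<^sup>2 / (2 * \<mu>)) \<le> g y + ereal ((norm (y - q))\<^sup>2 / (2 * \<mu>))"
proof -
  have "continuous_on UNIV (\<lambda>y. (norm (y - q))\<^sup>2 / (2 * \<mu>))"
    using \<mu> by (intro continuous_intros) auto
  from lower_semicontinuous_attains_min[OF lsc this compact_cball, of xbar \<rho>]
  have "\<exists>u. u \<in> cball xbar \<rho> \<and> (\<forall>y\<in>cball xbar \<rho>.
     g u + ereal ((norm (u - q))\<^sup>2 / (2 * \<mu>)) \<le> g y + ereal ((norm (y - q))\<^sup>2 / (2 * \<mu>)))"
    using \<rho> by auto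
  from someI_ex[OF this] show "prox q \<in> cball xbar \<rho>"
    "y \<in> cball xbar \<rho> \<Longrightarrow>
      g (prox q) + ereal ((norm (prox q - q))\<^sup>2 / (2 * \<mu>)) \<le> g y + ereal ((norm (y - q))\<^sup>2 / (2 * \<mu>))"
    unfolding prox_def[symmetric] by auto
qed

lemma prox_finite: "\<bar>g (prox q)\<bar> \<noteq> \<infinity>"
  using prox_minimizes(2)[of xbar q] not_MInf[of "prox q"] \<rho> limiting_subdifferential_finite[OF base]
  by (cases "g xbar"; cases "g (prox q)") auto

lemma prox_le:
  assumes "y \<in> cball xbar \<rho>" "\<bar>g y\<bar> \<noteq> \<infinity>"
  shows "val (prox q) + (norm (prox q - q))\<^sup>2 / (2 * \<mu>) \<le> val y + (norm (y - q))\<^sup>2 / (2 * \<mu>)"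
  using prox_minimizes(2)[OF assms(1), of q] val[OF prox_finite[of q]] val[OF assms(2)] by simp

lemma prox_plus_grad: "prox q + \<mu> *\<^sub>R grad q = q"
  using \<mu> by (simp add: grad_def)

text \<open>The prox-regularity inequality at \<open>(u, v)\<close> says that the objective for the parameter
  \<open>u + \<mu> *\<^sub>R v\<close> grows quadratically around \<open>u\<close>, with rate \<open>c / (2 * \<mu>)\<close>.  Changing the
  parameter perturbs the objective linearly, so the minimizer moves at most linearly.  Uniqueness
  and Lipschitz continuity of \<open>prox\<close> are both instances.\<close>

lemma prox_stability:
  assumes T: "(u, v) \<in> T" and u: "u \<in> cball xbar \<rho>" and v: "v \<in> cball vhat \<rho>"
  shows "norm (prox q - u) \<le> 2 / c * norm (q - (u + \<mu> *\<^sub>R v))"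
proof -
  let ?p = "prox q" and ?e = "q - (u + \<mu> *\<^sub>R v)"
  have fin: "\<bar>g u\<bar> \<noteq> \<infinity>"
    using T by (rule T_finite)
  have "v \<bullet> (?p - u) - r / 2 * (norm (?p - u))\<^sup>2 \<le> val ?p - val u"
    using ineq_real[OF T u v prox_minimizes(1) prox_finite, of q] by simp
  also have "\<dots> \<le> ((norm (u - q))\<^sup>2 - (norm (?p - q))\<^sup>2) / (2 * \<mu>)"
    using prox_le[OF u fin, of q] by (simp add: diff_divide_distrib)
  also have "(norm (u - q))\<^sup>2 - (norm (?p - q))\<^sup>2 = 2 * ((q - u) \<bullet> (?p - u)) - (norm (?p - u))\<^sup>2"
    by (simp only: power2_norm_eq_inner) (simp add: algebra_simps inner_commute)
  finally have "2 * \<mu> * (v \<bullet> (?p - u)) - r * \<mu> * (norm (?p - u))\<^sup>2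
      \<le> 2 * ((q - u) \<bullet> (?p - u)) - (norm (?p - u))\<^sup>2"
    using \<mu> by (simp add: field_simps)
  then have "c * (norm (?p - u))\<^sup>2 \<le> 2 * (?e \<bullet> (?p - u))"
    by (simp add: c_def algebra_simps)
  also have "\<dots> \<le> 2 * (norm ?e * norm (?p - u))"
    using norm_cauchy_schwarz[of ?e "?p - u"] by simp
  finally have "norm (?p - u) * (c * norm (?p - u)) \<le> norm (?p - u) * (2 * norm ?e)"
    by (simp add: power2_eq_square algebra_simps)
  then have "c * norm (?p - u) \<le> 2 * norm ?e"
    by (cases "?p = u") (auto simp: mult_le_cancel_left)
  then show ?thesis
    using c by (simp add: field_simps)
qed

lemma grad_stability:
  assumes "(u, v) \<in> T" "u \<in> cball xbar \<rho>" "v \<in> cball vhat \<rho>"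
  shows "norm (grad q - v) \<le> 3 / (c * \<mu>) * norm (q - (u + \<mu> *\<^sub>R v))"
proof -
  let ?e = "q - (u + \<mu> *\<^sub>R v)"
  have "\<mu> *\<^sub>R (grad q - v) = ?e - (prox q - u)"
    using prox_plus_grad[of q] by (simp add: algebra_simps)
  then have "\<mu> * norm (grad q - v) = norm (?e - (prox q - u))"
    using \<mu> by (metis norm_scaleR abs_of_pos)
  also have "\<dots> \<le> norm ?e + 2 / c * norm ?e"
    using norm_triangle_ineq4[of ?e "prox q - u"] prox_stability[OF assms, of q] by linarith
  also have "\<dots> \<le> 1 / c * norm ?e + 2 / c * norm ?e"
    using c mult_right_mono[of 1 "1 / c" "norm ?e"] by simp
  finally show ?thesis
    using c \<mu> by (simp add: field_simps)
qed

lemma base_in_balls: "(xbar, vhat) \<in> T" "xbar \<in> cball xbar \<rho>" "vhat \<in> cball vhat \<rho>"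
  using base \<rho> by auto

lemma prox_near_base: "norm (prox q - xbar) \<le> 2 / c * norm (q - qbar)"
  and grad_near_base: "norm (grad q - vhat) \<le> 3 / (c * \<mu>) * norm (q - qbar)"
  unfolding qbar_def
  by (rule prox_stability[OF base_in_balls], rule grad_stability[OF base_in_balls])

text \<open>Every point of \<open>T\<close> near the base point is reached by the parametrization, with parameter
  \<open>u + \<mu> *\<^sub>R v\<close>.\<close>

lemma prox_eq:
  assumes "(u, v) \<in> T" "u \<in> cball xbar \<rho>" "v \<in> cball vhat \<rho>"
  shows "prox (u + \<mu> *\<^sub>R v) = u" "grad (u + \<mu> *\<^sub>R v) = v"
  using prox_stability[OF assms, of "u + \<mu> *\<^sub>R v"] grad_stability[OF assms, of "u + \<mu> *\<^sub>R v"]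
  by auto

text \<open>Near \<open>qbar\<close> the minimizer lies in the interior of the ball, hence the first-order
  condition holds and the parametrization takes its values in \<open>T\<close>.\<close>

lemma prox_grad_near:
  assumes "q \<in> ball qbar \<delta>"
  shows "prox q \<in> ball xbar \<rho>" "grad q \<in> ball vhat \<rho>" "(prox q, grad q) \<in> T"
proof -
  have q: "norm (q - qbar) < \<delta>"
    using assms by (simp add: dist_norm norm_minus_commute)
  have "2 / c * norm (q - qbar) \<le> 2 / c * (c * \<rho> / 4)"
    using q \<delta> c by (intro mult_left_mono) auto
  then show p: "prox q \<in> ball xbar \<rho>"
    using prox_near_base[of q] c \<rho> by (simp add: dist_norm norm_minus_commute)
  have "3 / (c * \<mu>) * norm (q - qbar) \<le> 3 / (c * \<mu>) * (c * \<mu> * \<rho> / 4)"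
    using q \<delta> c \<mu> by (intro mult_left_mono) auto
  then show "grad q \<in> ball vhat \<rho>"
    using grad_near_base[of q] c \<rho> \<mu> by (simp add: dist_norm norm_minus_commute)
  have "grad q \<in> frechet_subdifferential g (prox q)"
  proof (rule proximal_imp_frechet_subgradient[where C = "1 / (2 * \<mu>)"])
    have "\<forall>\<^sub>F y in at (prox q). y \<in> ball xbar \<rho>"
      using p by (intro eventually_at_in_open') auto
    then show "\<forall>\<^sub>F y in at (prox q).
        g (prox q) + ereal (grad q \<bullet> (y - prox q) - 1 / (2 * \<mu>) * (norm (y - prox q))\<^sup>2) \<le> g y"
    proof eventually_elim
      case (elim y)
      show ?case
      proof (cases "g y = \<infinity>")
        case False
        then have fin: "\<bar>g y\<bar> \<noteq> \<infinity>" using not_MInf[of y] by auto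
        have "(norm (prox q - q))\<^sup>2 - (norm (y - q))\<^sup>2
            = 2 * ((q - prox q) \<bullet> (y - prox q)) - (norm (y - prox q))\<^sup>2"
          by (simp only: power2_norm_eq_inner) (simp add: algebra_simps inner_commute)
        then have "(norm (prox q - q))\<^sup>2 / (2 * \<mu>) - (norm (y - q))\<^sup>2 / (2 * \<mu>)
            = grad q \<bullet> (y - prox q) - 1 / (2 * \<mu>) * (norm (y - prox q))\<^sup>2"
          using \<mu> by (simp add: grad_def diff_divide_distrib[symmetric])
             (simp add: diff_divide_distrib)
        moreover have "y \<in> cball xbar \<rho>" using elim by simp
        ultimately show ?thesis
          using prox_le[OF _ fin, of q] val[OF fin] val[OF prox_finite[of q]] by simp
      qed simp
    qed
  qed (rule prox_finite)
  then show "(prox q, grad q) \<in> T"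
    by (simp add: frechet_imp_limiting)
qed

lemma prox_grad_near':
  assumes "q \<in> ball qbar \<delta>"
  shows "(prox q, grad q) \<in> T" "prox q \<in> cball xbar \<rho>" "grad q \<in> cball vhat \<rho>"
  using prox_grad_near[OF assms] by auto

lemma prox_lipschitz: "q' \<in> ball qbar \<delta> \<Longrightarrow> norm (prox q - prox q') \<le> 2 / c * norm (q - q')"
  and grad_lipschitz: "q' \<in> ball qbar \<delta> \<Longrightarrow> norm (grad q - grad q') \<le> 3 / (c * \<mu>) * norm (q - q')"
  using prox_stability[of "prox q'" "grad q'" q] grad_stability[of "prox q'" "grad q'" q]
    prox_grad_near'[of q'] by (auto simp: prox_plus_grad)

lemma hypomonotone:
  assumes "(u, v) \<in> T" "u \<in> cball xbar \<rho>" "v \<in> cball vhat \<rho>"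
    and "(u', v') \<in> T" "u' \<in> cball xbar \<rho>" "v' \<in> cball vhat \<rho>"
  shows "- r * (norm (u' - u))\<^sup>2 \<le> (v' - v) \<bullet> (u' - u)"
proof -
  have "\<bar>g u\<bar> \<noteq> \<infinity>" and "\<bar>g u'\<bar> \<noteq> \<infinity>"
    by (rule T_finite[OF assms(1)], rule T_finite[OF assms(4)])
  then have "val u + v \<bullet> (u' - u) - r / 2 * (norm (u' - u))\<^sup>2 \<le> val u'"
    "val u' + v' \<bullet> (u - u') - r / 2 * (norm (u - u'))\<^sup>2 \<le> val u"
    using ineq_real[of u v u'] ineq_real[of u' v' u] assms by auto
  then show ?thesis
    by (simp add: norm_minus_commute[of u u'] algebra_simps)
qed

section \<open>Normals to the subdifferential graph\<close>

text \<open>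
  The operator with graph \<open>{(u, v + r u)}\<close> over \<open>T\<close> is locally monotone, and the normal \<open>(z, - w)\<close>
  turns into \<open>(z + r w, - w)\<close>.  Moving the parameter by \<open>t * c * D\<close> moves the graph point by
  \<open>(a, b)\<close> with \<open>a + \<mu> b = t c D\<close>; monotonicity confines \<open>a\<close> to the ball with
  diameter \<open>[0, t D]\<close>.  Inserting this into the normal inequality and letting \<open>t\<close> tend to \<open>0\<close>
  gives \<open>norm D \<le> norm S\<close>, where \<open>S\<close> and \<open>D\<close> are the sum and difference of
  \<open>z + r w\<close> and \<open>(c / \<mu>) w\<close>; by polarization this is \<open>(z + r w) \<bullet> w \<ge> 0\<close>.
\<close>

lemma frechet_normal_lower_bound:
  assumes n: "(z, - w) \<in> frechet_subdifferential (indicator_fun T) (u, v)"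
    and u: "u \<in> cball xbar \<rho>" and v: "v \<in> cball vhat \<rho>" and q: "u + \<mu> *\<^sub>R v \<in> ball qbar \<delta>"
  shows "- r * (norm w)\<^sup>2 \<le> z \<bullet> w"
proof -
  have uv: "(u, v) \<in> T"
    and normal: "\<And>e. e > 0 \<Longrightarrow> \<forall>\<^sub>F y in at (u, v). y \<in> T \<longrightarrow> (z, - w) \<bullet> (y - (u, v)) \<le> e * norm (y - (u, v))"
    using n by (auto simp: frechet_normal_iff)
  \<comment> \<open>The direction \<open>D\<close> is optimal: it makes the Cauchy-Schwarz estimates below sharp.\<close>
  define D where "D = z + r *\<^sub>R w - (c / \<mu>) *\<^sub>R w"
  define S where "S = z + (1 / \<mu>) *\<^sub>R w"
  have S: "S = D + (2 * c / \<mu>) *\<^sub>R w"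
  proof -
    have "1 / \<mu> = r - c / \<mu> + 2 * c / \<mu>"
      using \<mu> by (simp add: c_def field_simps)
    then show ?thesis
      unfolding S_def D_def by (simp only: scaleR_add_left scaleR_diff_left) simp
  qed
  define K where "K = norm D * (2 + 3 / \<mu>)"
  have K: "0 \<le> K" using \<mu> by (simp add: K_def)
  have approx: "D \<bullet> D - norm S * norm D \<le> 2 * (e * K)" if e: "0 < e" for e
  proof -
    obtain d where d: "0 < d" and nd: "\<And>y. y \<in> T \<Longrightarrow> dist y (u, v) < d \<Longrightarrow>
        (z, - w) \<bullet> (y - (u, v)) \<le> e * norm (y - (u, v))"
    proof -
      obtain d where d: "0 < d" "\<forall>y. y \<noteq> (u, v) \<and> dist y (u, v) < d \<longrightarrow> y \<in> T \<longrightarrow>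
          (z, - w) \<bullet> (y - (u, v)) \<le> e * norm (y - (u, v))"
        using normal[OF e] unfolding eventually_at by auto
      have "(z, - w) \<bullet> (y - (u, v)) \<le> e * norm (y - (u, v))" if "y \<in> T" "dist y (u, v) < d" for y
        using d(2) that by (cases "y = (u, v)") (simp, blast)
      with d(1) show ?thesis by (rule that)
    qed
    let ?q = "\<lambda>t::real. u + \<mu> *\<^sub>R v + t *\<^sub>R (c *\<^sub>R D)"
    have "(?q \<longlongrightarrow> ?q 0) (at_right 0)" "((\<lambda>t. t * K) \<longlongrightarrow> 0 * K) (at_right 0)"
      by (intro tendsto_intros)+
    then have lim: "(?q \<longlongrightarrow> u + \<mu> *\<^sub>R v) (at_right 0)" "((\<lambda>t. t * K) \<longlongrightarrow> 0) (at_right 0)"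
      by auto
    have "\<forall>\<^sub>F t in at_right 0. ?q t \<in> ball qbar \<delta>"
      by (rule topological_tendstoD[OF lim(1) open_ball q])
    moreover have "\<forall>\<^sub>F t in at_right 0. t * K < d"
      by (rule order_tendstoD(2)[OF lim(2) d])
    moreover have "\<forall>\<^sub>F t in at_right (0::real). 0 < t"
      by (rule eventually_at_right_less)
    ultimately have "\<forall>\<^sub>F t in at_right 0. ?q t \<in> ball qbar \<delta> \<and> t * K < d \<and> 0 < t"
      by eventually_elim auto
    then obtain t where t: "?q t \<in> ball qbar \<delta>" "t * K < d" "0 < t"
      using eventually_happens'[OF trivial_limit_at_right_real] by blast
    define a where "a = prox (?q t) - u"
    define b where "b = grad (?q t) - v"
    have ab: "\<mu> *\<^sub>R b = t *\<^sub>R (c *\<^sub>R D) - a"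
      using prox_plus_grad[of "?q t"] by (simp add: a_def b_def algebra_simps)
    have b: "b = (1 / \<mu>) *\<^sub>R (t *\<^sub>R (c *\<^sub>R D) - a)"
      unfolding ab[symmetric] using \<mu> by simp
    have na: "norm a \<le> 2 * t * norm D"
      using prox_stability[OF uv u v, of "?q t"] t(3) c by (simp add: a_def)
    have nb: "norm b \<le> 3 / \<mu> * t * norm D"
      using grad_stability[OF uv u v, of "?q t"] t(3) c by (simp add: b_def)
    have ab_norm: "norm (a, b) \<le> t * K"
    proof -
      have "norm (a, b) \<le> norm a + norm b"
        by (rule norm_Pair_le)
      also have "\<dots> \<le> 2 * t * norm D + 3 / \<mu> * t * norm D"
        using na nb by simp
      also have "\<dots> = t * K"
        by (simp add: K_def algebra_simps)
      finally show ?thesis .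
    qed
    have ab_diff: "(prox (?q t), grad (?q t)) - (u, v) = (a, b)"
      by (simp add: a_def b_def)
    have "(z, - w) \<bullet> (a, b) \<le> e * norm (a, b)"
      using nd[OF prox_grad_near'(1)[OF t(1)]] ab_norm t(2)
      unfolding dist_norm ab_diff by simp
    also have "\<dots> \<le> e * (t * K)"
      using ab_norm e by simp
    finally have "z \<bullet> a - w \<bullet> b \<le> t * (e * K)"
      by (simp add: algebra_simps)
    moreover have "z \<bullet> a - w \<bullet> b = S \<bullet> a - t * (c / \<mu>) * (w \<bullet> D)"
      using \<mu> unfolding b S_def by (simp add: inner_diff_right inner_add_left field_simps)
    ultimately have F1: "S \<bullet> a - t * (c / \<mu>) * (w \<bullet> D) \<le> t * (e * K)"
      by simp
    have "- r * (norm a)\<^sup>2 \<le> b \<bullet> a"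
      using hypomonotone[OF uv u v prox_grad_near'[OF t(1)]] by (simp add: a_def b_def)
    also have "b \<bullet> a = (t * c * (D \<bullet> a) - a \<bullet> a) / \<mu>"
      using \<mu> unfolding b by (simp add: inner_diff_left field_simps)
    finally have "c * (a \<bullet> a) \<le> c * (t * (D \<bullet> a))"
      using \<mu> by (simp add: c_def power2_norm_eq_inner field_simps)
    then have F2: "a \<bullet> a \<le> t * (D \<bullet> a)"
      using c by simp
    \<comment> \<open>The hypomonotonicity estimate \<open>a \<bullet> a \<le> t * (D \<bullet> a)\<close> describes a ball with centre
      \<open>(t / 2) *\<^sub>R D\<close>.\<close>
    let ?m = "a - (t / 2) *\<^sub>R D"
    have "(norm ?m)\<^sup>2 \<le> (t / 2 * norm D)\<^sup>2"
      using F2 unfolding power_mult_distrib power2_norm_eq_inner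
      by (simp add: algebra_simps inner_commute power2_eq_square)
    then have "norm ?m \<le> t / 2 * norm D"
      using t(3) by (auto intro: power2_le_imp_le)
    then have "norm S * norm ?m \<le> norm S * (t / 2 * norm D)"
      by (intro mult_left_mono) auto
    then have "- (norm S * (t / 2 * norm D)) \<le> S \<bullet> ?m"
      using Cauchy_Schwarz_ineq2[of S ?m] by simp
    then have "t / 2 * (S \<bullet> D) - norm S * (t / 2 * norm D) \<le> S \<bullet> a"
      by (simp add: inner_diff_right)
    moreover have "S \<bullet> D = D \<bullet> D + (2 * c / \<mu>) * (w \<bullet> D)"
      by (simp add: S inner_add_left)
    ultimately have "t / 2 * (D \<bullet> D - norm S * norm D) \<le> t * (e * K)"
      using F1 by (simp add: algebra_simps)
    then have "t * (D \<bullet> D - norm S * norm D) \<le> t * (2 * (e * K))"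
      by simp
    then show ?thesis
      using t(3) by simp
  qed
  have "D \<bullet> D - norm S * norm D \<le> 0"
  proof (rule ccontr)
    define x where "x = D \<bullet> D - norm S * norm D"
    assume "\<not> D \<bullet> D - norm S * norm D \<le> 0"
    then have x: "0 < x" by (simp add: x_def)
    have "x \<le> 2 * (x / (4 * (K + 1)) * K)"
      using approx[of "x / (4 * (K + 1))"] x K unfolding x_def[symmetric] by auto
    also have "\<dots> = x / 2 * (K / (K + 1))"
      using K by (simp add: field_simps)
    also have "\<dots> \<le> x / 2 * 1"
      using x K by (intro mult_left_mono) auto
    finally show False using x by simp
  qed
  then have "norm D * norm D \<le> norm S * norm D"
    by (simp add: dot_square_norm power2_eq_square)
  then have "norm D \<le> norm S"
    by (cases "D = 0") auto
  then have "D \<bullet> D \<le> S \<bullet> S"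
    by (simp add: norm_le)
  also have "S \<bullet> S = D \<bullet> D + 4 * c / \<mu> * (w \<bullet> (D + (c / \<mu>) *\<^sub>R w))"
    unfolding S by (simp add: algebra_simps inner_commute)
  also have "D + (c / \<mu>) *\<^sub>R w = z + r *\<^sub>R w"
    by (simp add: D_def)
  finally have "0 \<le> 4 * c / \<mu> * (w \<bullet> (z + r *\<^sub>R w))"
    by simp
  moreover have "0 < 4 * c / \<mu>"
    using c \<mu> by simp
  ultimately have "0 \<le> w \<bullet> (z + r *\<^sub>R w)"
    by (simp only: zero_le_mult_iff) auto
  then show ?thesis
    by (simp add: inner_add_right power2_norm_eq_inner inner_commute)
qed

lemma tau0_lower_bound: "ereal (- r) \<le> tau0 g xbar vhat"
  unfolding tau0_def
proof (rule Inf_greatest, clarify)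
  fix z w :: 'a
  assume "z \<in> limiting_coderivative (limiting_subdifferential g) xbar vhat w" and w: "w \<noteq> 0"
  then obtain ps ns where
    fn: "\<And>k. ns k \<in> frechet_subdifferential (indicator_fun T) (ps k)"
    and ps: "ps \<longlonglongrightarrow> (xbar, vhat)" and ns: "ns \<longlonglongrightarrow> (z, - w)"
    unfolding limiting_coderivative_def limiting_normal_iff by auto
  let ?u = "\<lambda>k. fst (ps k)" and ?v = "\<lambda>k. snd (ps k)"
  let ?z = "\<lambda>k. fst (ns k)" and ?w = "\<lambda>k. - snd (ns k)"
  have u: "?u \<longlonglongrightarrow> xbar" and v: "?v \<longlonglongrightarrow> vhat" and zlim: "?z \<longlonglongrightarrow> z" and wlim: "?w \<longlonglongrightarrow> - (- w)"
    using tendsto_fst[OF ps] tendsto_snd[OF ps] tendsto_fst[OF ns]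
      tendsto_minus[OF tendsto_snd[OF ns]] by auto
  have "(\<lambda>k. ?u k + \<mu> *\<^sub>R ?v k) \<longlonglongrightarrow> qbar"
    unfolding qbar_def by (intro tendsto_intros u v)
  then have "\<forall>\<^sub>F k in sequentially. ?u k + \<mu> *\<^sub>R ?v k \<in> ball qbar \<delta>"
    by (rule topological_tendstoD) (use \<delta> in auto)
  moreover have "\<forall>\<^sub>F k in sequentially. ?u k \<in> ball xbar \<rho>"
    by (rule topological_tendstoD[OF u]) (use \<rho> in auto)
  moreover have "\<forall>\<^sub>F k in sequentially. ?v k \<in> ball vhat \<rho>"
    by (rule topological_tendstoD[OF v]) (use \<rho> in auto)
  ultimately have "\<forall>\<^sub>F k in sequentially. - r * (norm (?w k))\<^sup>2 \<le> ?z k \<bullet> ?w k"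
  proof eventually_elim
    case (elim k)
    show ?case
      by (rule frechet_normal_lower_bound[where u = "?u k" and v = "?v k"])
         (use elim fn[of k] in auto)
  qed
  moreover have "(\<lambda>k. - r * (norm (?w k))\<^sup>2) \<longlonglongrightarrow> - r * (norm (- (- w)))\<^sup>2"
    "(\<lambda>k. ?z k \<bullet> ?w k) \<longlonglongrightarrow> z \<bullet> (- (- w))"
    by (intro tendsto_intros wlim zlim)+
  ultimately have "- r * (norm (- (- w)))\<^sup>2 \<le> z \<bullet> (- (- w))"
    by (intro tendsto_le[OF sequentially_bot])
  then show "ereal (- r) \<le> ereal ((z \<bullet> w) / (norm w)\<^sup>2)"
    using w by (simp add: pos_le_divide_eq)
qed

text \<open>Since \<open>prox (u + \<mu> *\<^sub>R v) = u\<close> on \<open>T\<close>, the linear map \<open>(u, v) \<mapsto> u + \<mu> *\<^sub>R v\<close>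
  turns a proximal subgradient of \<open>d \<bullet> prox\<close> into a normal to \<open>T\<close>.\<close>

lemma prox_subgradient_frechet_normal:
  assumes q: "q \<in> ball qbar \<delta>"
    and sub: "\<forall>\<^sub>F y in nhds q. d \<bullet> prox q + x \<bullet> (y - q) - C * (norm (y - q))\<^sup>2 \<le> d \<bullet> prox y"
  shows "(x - d, \<mu> *\<^sub>R x) \<in> frechet_subdifferential (indicator_fun T) (prox q, grad q)"
proof (rule proximal_imp_frechet_normal[where C = "\<bar>C\<bar> * (1 + \<mu>)\<^sup>2"])
  let ?p = "(prox q, grad q)"
  show "?p \<in> T" using prox_grad_near[OF q] by simp
  have "((\<lambda>y. fst y + \<mu> *\<^sub>R snd y) \<longlongrightarrow> fst ?p + \<mu> *\<^sub>R snd ?p) (at ?p)"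
    by (intro tendsto_intros)
  then have "((\<lambda>y. fst y + \<mu> *\<^sub>R snd y) \<longlongrightarrow> q) (at ?p)"
    by (simp add: prox_plus_grad)
  then have "\<forall>\<^sub>F y in at ?p. d \<bullet> prox q + x \<bullet> (fst y + \<mu> *\<^sub>R snd y - q)
      - C * (norm (fst y + \<mu> *\<^sub>R snd y - q))\<^sup>2 \<le> d \<bullet> prox (fst y + \<mu> *\<^sub>R snd y)"
    using sub unfolding filterlim_iff by blast
  moreover have "\<forall>\<^sub>F y in at ?p. y \<in> ball xbar \<rho> \<times> ball vhat \<rho>"
    using prox_grad_near[OF q] by (intro eventually_at_in_open') (auto intro: open_Times)
  ultimately show "\<forall>\<^sub>F y in at ?p. y \<in> T \<longrightarrow>
      (x - d, \<mu> *\<^sub>R x) \<bullet> (y - ?p) \<le> \<bar>C\<bar> * (1 + \<mu>)\<^sup>2 * (norm (y - ?p))\<^sup>2"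
  proof eventually_elim
    case (elim y)
    show ?case
    proof
      assume y: "y \<in> T"
      obtain u v where [simp]: "y = (u, v)" by force
      let ?a = "u - prox q" and ?b = "v - grad q"
      have e: "u + \<mu> *\<^sub>R v - q = ?a + \<mu> *\<^sub>R ?b"
        using prox_plus_grad[of q] by (simp add: algebra_simps)
      have "prox (u + \<mu> *\<^sub>R v) = u"
        using y elim(2) by (intro prox_eq) auto
      then have "d \<bullet> prox q + x \<bullet> (?a + \<mu> *\<^sub>R ?b) - C * (norm (?a + \<mu> *\<^sub>R ?b))\<^sup>2 \<le> d \<bullet> u"
        using elim(1) e by simp
      moreover have "(x - d, \<mu> *\<^sub>R x) \<bullet> (y - ?p) = x \<bullet> (?a + \<mu> *\<^sub>R ?b) - d \<bullet> u + d \<bullet> prox q"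
        by (simp add: algebra_simps)
      ultimately have "(x - d, \<mu> *\<^sub>R x) \<bullet> (y - ?p) \<le> C * (norm (?a + \<mu> *\<^sub>R ?b))\<^sup>2"
        by simp
      also have "\<dots> \<le> \<bar>C\<bar> * (norm (?a + \<mu> *\<^sub>R ?b))\<^sup>2"
        by (intro mult_right_mono) auto
      also have "\<dots> \<le> \<bar>C\<bar> * ((1 + \<mu>) * norm (y - ?p))\<^sup>2"
      proof (intro mult_left_mono power_mono)
        have "norm (?a + \<mu> *\<^sub>R ?b) \<le> norm ?a + \<mu> * norm ?b"
          using norm_triangle_ineq[of ?a "\<mu> *\<^sub>R ?b"] \<mu> by simp
        also have "\<dots> \<le> norm (y - ?p) + \<mu> * norm (y - ?p)"
          using \<mu> norm_fst_le[of ?a ?b] norm_snd_le[of ?b ?a] by (intro add_mono mult_left_mono) auto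
        finally show "norm (?a + \<mu> *\<^sub>R ?b) \<le> (1 + \<mu>) * norm (y - ?p)"
          by (simp add: algebra_simps)
      qed auto
      finally show "(x - d, \<mu> *\<^sub>R x) \<bullet> (y - ?p) \<le> \<bar>C\<bar> * (1 + \<mu>)\<^sup>2 * (norm (y - ?p))\<^sup>2"
        by (simp add: power_mult_distrib mult.assoc)
    qed
  qed
qed

text \<open>The mean value inequality is applied to \<open>d \<bullet> prox y - L * (d \<bullet> y)\<close> with \<open>d\<close> the
  unit vector along \<open>a - b\<close>; this function increases from \<open>b\<close> to \<open>a\<close> exactly
  when \<open>prox\<close> expands by more than \<open>L\<close> along \<open>d\<close>.  The fraction \<open>e / 5\<close> leaves room for the
  ball of radius \<open>2 * norm (a - b)\<close> in which the subgradient is found.\<close>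

lemma expansion_yields_frechet_normal:
  assumes e: "e \<le> \<delta>"
    and a: "a \<in> ball qbar (e / 5)" and b: "b \<in> ball qbar (e / 5)"
    and expand: "L * (norm (a - b))\<^sup>2 < (prox a - prox b) \<bullet> (a - b)"
  shows "\<exists>q d x. q \<in> ball qbar e \<and> norm d = 1 \<and> L \<le> x \<bullet> d \<and>
    (x - d, \<mu> *\<^sub>R x) \<in> frechet_subdifferential (indicator_fun T) (prox q, grad q)"
proof -
  define l where "l = norm (a - b)"
  have l: "0 < l" using expand by (auto simp: l_def)
  define d where "d = (1 / l) *\<^sub>R (a - b)"
  have d: "norm d = 1" "a - b = l *\<^sub>R d"
    using l by (auto simp: d_def) (simp add: l_def)
  let ?F = "\<lambda>y. d \<bullet> prox y - (L *\<^sub>R d) \<bullet> y"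
  have l_less: "l < 2 * e / 5"
    using a b dist_triangle_less_add[of a qbar "e/5" b "e/5"]
    by (simp add: l_def dist_norm norm_minus_commute)
  have sub: "y \<in> ball qbar e" if "norm (y - b) \<le> 2 * l" for y
  proof -
    have "norm (y - qbar) \<le> norm (y - b) + norm (b - qbar)"
      using norm_triangle_ineq[of "y - b" "b - qbar"] by simp
    then show ?thesis
      using that l_less b by (simp add: dist_norm norm_minus_commute)
  qed
  have "\<exists>q x C. norm (q - b) \<le> 2 * norm (a - b) \<and> 0 \<le> x \<bullet> (a - b) \<and>
    (\<forall>\<^sub>F y in nhds q. ?F q + x \<bullet> (y - q) - C * (norm (y - q))\<^sup>2 \<le> ?F y)"
  proof (rule lipschitz_ascent_subgradient[where K = "2 / c + \<bar>L\<bar>"])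
    fix x y
    assume "y \<in> cball b (2 * norm (a - b))"
    then have y: "y \<in> ball qbar \<delta>"
      using sub[of y] e by (simp add: l_def dist_norm norm_minus_commute)
    have "?F x - ?F y = d \<bullet> (prox x - prox y) - L * (d \<bullet> (x - y))"
      by (simp add: algebra_simps)
    then have "\<bar>?F x - ?F y\<bar> \<le> \<bar>d \<bullet> (prox x - prox y)\<bar> + \<bar>L\<bar> * \<bar>d \<bullet> (x - y)\<bar>"
      by (simp add: abs_triangle_ineq4 flip: abs_mult)
    also have "\<dots> \<le> norm (prox x - prox y) + \<bar>L\<bar> * norm (x - y)"
      using Cauchy_Schwarz_ineq2[of d] d(1) by (intro add_mono mult_left_mono) auto
    also have "\<dots> \<le> 2 / c * norm (x - y) + \<bar>L\<bar> * norm (x - y)"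
      using prox_lipschitz[OF y] by simp
    finally show "\<bar>?F x - ?F y\<bar> \<le> (2 / c + \<bar>L\<bar>) * norm (x - y)"
      by (simp add: algebra_simps)
  next
    have "l * (L * l) < l * (d \<bullet> (prox a - prox b))"
      using expand d by (simp add: power2_eq_square inner_commute mult.left_commute)
    then have "L * l < d \<bullet> (prox a - prox b)"
      using l by simp
    moreover have "L * l = (L *\<^sub>R d) \<bullet> (a - b)"
      using d by (simp add: dot_square_norm)
    ultimately show "?F b < ?F a"
      by (simp add: inner_diff_right)
  qed
  then obtain q x C where q: "norm (q - b) \<le> 2 * l" and x: "0 \<le> x \<bullet> (a - b)"
    and ev: "\<forall>\<^sub>F y in nhds q. ?F q + x \<bullet> (y - q) - C * (norm (y - q))\<^sup>2 \<le> ?F y"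
    unfolding l_def by blast
  have "L \<le> (x + L *\<^sub>R d) \<bullet> d"
    using x l d by (simp add: inner_add_left dot_square_norm zero_le_mult_iff)
  moreover have "(x + L *\<^sub>R d - d, \<mu> *\<^sub>R (x + L *\<^sub>R d))
      \<in> frechet_subdifferential (indicator_fun T) (prox q, grad q)"
  proof (rule prox_subgradient_frechet_normal)
    show "q \<in> ball qbar \<delta>" using sub[OF q] e by simp
    show "\<forall>\<^sub>F y in nhds q. d \<bullet> prox q + (x + L *\<^sub>R d) \<bullet> (y - q) - C * (norm (y - q))\<^sup>2 \<le> d \<bullet> prox y"
      using ev by (rule eventually_mono) (simp add: algebra_simps)
  qed
  ultimately show ?thesis
    using sub[OF q] d(1) by blast
qed

text \<open>
  The coderivative condition constrains limiting normals at the base point only, and only those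
  with \<open>w \<noteq> 0\<close>.  The normals \<open>(x - d, \<mu> *\<^sub>R x)\<close> produced by an expansion beyond \<open>L\<close> survive
  both restrictions: \<open>x\<close> is bounded above by the lower bound for normals, and bounded away from
  \<open>0\<close> by \<open>x \<bullet> d \<ge> L\<close>.  For the limit, \<open>L \<le> x \<bullet> d \<le> norm x\<close> gives
  \<open>x \<bullet> d \<le> (norm x)\<^sup>2 / L\<close>, which is \<open>z \<bullet> w \<le> - s * (norm w)\<^sup>2\<close> for \<open>z = x - d\<close> and
  \<open>w = - \<mu> *\<^sub>R x\<close>.
\<close>

lemma tau0_controls_prox_expansion:
  assumes s: "0 < s" "s * \<mu> < 1" and tau: "ereal (- s) < tau0 g xbar vhat"
  shows "\<exists>e>0. e \<le> \<delta> \<and> (\<forall>a\<in>ball qbar e. \<forall>b\<in>ball qbar e.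
    (prox a - prox b) \<bullet> (a - b) \<le> 1 / (1 - s * \<mu>) * (norm (a - b))\<^sup>2)"
proof (rule ccontr)
  assume neg: "\<not> ?thesis"
  define L where "L = 1 / (1 - s * \<mu>)"
  have L: "0 < L" "1 / L = 1 - s * \<mu>" using s by (auto simp: L_def)
  let ?e = "\<lambda>k::nat. \<delta> / real (Suc k)"
  have "\<exists>q d x. q \<in> ball qbar (?e k) \<and> norm d = 1 \<and> L \<le> x \<bullet> d \<and>
      (x - d, \<mu> *\<^sub>R x) \<in> frechet_subdifferential (indicator_fun T) (prox q, grad q)" for k
  proof -
    have e: "0 < ?e k / 5" "?e k \<le> \<delta>" "?e k / 5 \<le> \<delta>"
      using \<delta>(1) by (auto simp: field_simps)
    then obtain a b where "a \<in> ball qbar (?e k / 5)" "b \<in> ball qbar (?e k / 5)"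
      "L * (norm (a - b))\<^sup>2 < (prox a - prox b) \<bullet> (a - b)"
      using neg unfolding L_def by (meson not_le)
    then show ?thesis
      using e by (intro expansion_yields_frechet_normal)
  qed
  then obtain q d x where q: "\<And>k. q k \<in> ball qbar (?e k)" and d: "\<And>k. norm (d k) = 1"
    and x: "\<And>k. L \<le> x k \<bullet> d k" and n: "\<And>k. (x k - d k, \<mu> *\<^sub>R x k)
      \<in> frechet_subdifferential (indicator_fun T) (prox (q k), grad (q k))"
    by metis
  have q\<delta>: "q k \<in> ball qbar \<delta>" for k
  proof -
    have "?e k \<le> \<delta>" using \<delta>(1) by (auto simp: field_simps)
    with q[of k] show ?thesis by auto
  qed
  have qlim: "(\<lambda>k. norm (q k - qbar)) \<longlonglongrightarrow> 0"
  proof (rule tendsto_sandwich[of "\<lambda>_. 0" _ _ ?e])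
    show "\<forall>\<^sub>F k in sequentially. norm (q k - qbar) \<le> ?e k"
      using q by (intro always_eventually) (auto simp: dist_norm norm_minus_commute less_imp_le)
    have "(\<lambda>k. \<delta> * inverse (real (Suc k))) \<longlonglongrightarrow> \<delta> * 0"
      by (intro tendsto_intros LIMSEQ_inverse_real_of_nat)
    then show "?e \<longlonglongrightarrow> 0" by (simp add: divide_inverse)
  qed auto
  have "(\<lambda>k. prox (q k)) \<longlonglongrightarrow> xbar"
    by (rule LIM_zero_cancel,
        rule Lim_null_comparison[OF always_eventually
          tendsto_mult_right_zero[OF qlim, of "2 / c"]])
       (intro allI prox_near_base)
  moreover have "(\<lambda>k. grad (q k)) \<longlonglongrightarrow> vhat"
    by (rule LIM_zero_cancel,
        rule Lim_null_comparison[OF always_eventually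
          tendsto_mult_right_zero[OF qlim, of "3 / (c * \<mu>)"]])
       (intro allI grad_near_base)
  ultimately have plim: "(\<lambda>k. (prox (q k), grad (q k))) \<longlonglongrightarrow> (xbar, vhat)"
    by (rule tendsto_Pair)
  \<comment> \<open>The lower bound for normals, applied to \<open>z = x - d\<close> and \<open>w = - \<mu> *\<^sub>R x\<close>, reads
    \<open>c * (norm x)\<^sup>2 \<le> x \<bullet> d\<close>.\<close>
  have "norm (x k) \<le> 1 / c" for k
  proof -
    have "- r * (norm (- (\<mu> *\<^sub>R x k)))\<^sup>2 \<le> (x k - d k) \<bullet> (- (\<mu> *\<^sub>R x k))"
      using n[of k] prox_grad_near'[OF q\<delta>[of k]] q\<delta>[of k]
      by (intro frechet_normal_lower_bound[where u = "prox (q k)" and v = "grad (q k)"])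
         (auto simp: prox_plus_grad)
    then have "\<mu> * (x k \<bullet> x k) \<le> \<mu> * (x k \<bullet> d k + r * \<mu> * (x k \<bullet> x k))"
      by (simp only: norm_minus_cancel norm_scaleR power_mult_distrib power2_abs power2_norm_eq_inner)
         (simp add: algebra_simps inner_commute power2_eq_square)
    then have "x k \<bullet> x k \<le> x k \<bullet> d k + r * \<mu> * (x k \<bullet> x k)"
      using \<mu> by (simp only: mult_le_cancel_left_pos)
    then have "c * (norm (x k))\<^sup>2 \<le> x k \<bullet> d k"
      by (simp add: c_def power2_norm_eq_inner algebra_simps)
    also have "\<dots> \<le> norm (x k)"
      using norm_cauchy_schwarz[of "x k" "d k"] d[of k] by simp
    finally have "norm (x k) * (c * norm (x k)) \<le> norm (x k) * 1"
      by (simp add: power2_eq_square algebra_simps)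
    then have "c * norm (x k) \<le> 1"
      by (cases "x k = 0") (auto simp: mult_le_cancel_left)
    then show ?thesis using c by (simp add: field_simps)
  qed
  then have bounded: "\<forall>k. (d k, x k) \<in> cball 0 1 \<times> cball 0 (1 / c)"
    using d by simp
  have "seq_compact (cball (0::'a) 1 \<times> cball (0::'a) (1 / c))"
    by (intro compact_imp_seq_compact compact_Times compact_cball)
  then obtain dx \<sigma> where dx: "dx \<in> cball 0 1 \<times> cball 0 (1 / c)" and \<sigma>: "strict_mono \<sigma>"
    and lim: "((\<lambda>k. (d k, x k)) \<circ> \<sigma>) \<longlonglongrightarrow> dx"
    using bounded by (rule seq_compactE)
  obtain d' x' where [simp]: "dx = (d', x')" by force
  have dlim: "(\<lambda>k. d (\<sigma> k)) \<longlonglongrightarrow> d'" and xlim: "(\<lambda>k. x (\<sigma> k)) \<longlonglongrightarrow> x'"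
    using tendsto_fst[OF lim] tendsto_snd[OF lim] by (auto simp: o_def)
  have Lx: "L \<le> x' \<bullet> d'"
    by (rule tendsto_lowerbound[OF tendsto_inner[OF xlim dlim]]) (use x in auto)
  also have xd: "x' \<bullet> d' \<le> norm x'"
    using norm_cauchy_schwarz[of x' d'] dx mult_left_le[of "norm d'" "norm x'"] by simp
  finally have x'L: "L \<le> norm x'" .
  then have x': "x' \<noteq> 0" using L by auto
  have "(x' - d', \<mu> *\<^sub>R x') \<in> limiting_normal_cone T (xbar, vhat)"
    unfolding limiting_normal_iff
  proof (intro conjI exI allI)
    show "(xbar, vhat) \<in> T" using base by simp
    show "(x (\<sigma> k) - d (\<sigma> k), \<mu> *\<^sub>R x (\<sigma> k))
        \<in> frechet_subdifferential (indicator_fun T) (prox (q (\<sigma> k)), grad (q (\<sigma> k)))" for k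
      by (rule n)
    show "(\<lambda>k. (prox (q (\<sigma> k)), grad (q (\<sigma> k)))) \<longlonglongrightarrow> (xbar, vhat)"
      using LIMSEQ_subseq_LIMSEQ[OF plim \<sigma>] by (simp add: o_def)
    show "(\<lambda>k. (x (\<sigma> k) - d (\<sigma> k), \<mu> *\<^sub>R x (\<sigma> k))) \<longlonglongrightarrow> (x' - d', \<mu> *\<^sub>R x')"
      by (intro tendsto_intros xlim dlim)
  qed
  then have coder: "x' - d' \<in> limiting_coderivative (limiting_subdifferential g) xbar vhat (- (\<mu> *\<^sub>R x'))"
    by (simp add: limiting_coderivative_def)
  have "tau0 g xbar vhat
      \<le> ereal (((x' - d') \<bullet> (- (\<mu> *\<^sub>R x'))) / (norm (- (\<mu> *\<^sub>R x')))\<^sup>2)"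
    unfolding tau0_def using coder x' \<mu>
    by (intro Inf_lower CollectI exI[where x = "x' - d'"] exI[where x = "- (\<mu> *\<^sub>R x')"]) simp
  also have "\<dots> \<le> ereal (- s)"
  proof -
    have "norm x' * 1 \<le> norm x' * (norm x' * (1 / L))"
      using x'L L by (intro mult_left_mono) (auto simp: field_simps)
    also have "\<dots> = (1 - s * \<mu>) * (norm x')\<^sup>2"
      unfolding L(2) by (simp add: power2_eq_square)
    finally have "x' \<bullet> d' - (norm x')\<^sup>2 \<le> - s * \<mu> * (norm x')\<^sup>2"
      using xd by (simp add: algebra_simps)
    then have "\<mu> * (x' \<bullet> d' - (norm x')\<^sup>2) \<le> \<mu> * (- s * \<mu> * (norm x')\<^sup>2)"
      using \<mu> by (intro mult_left_mono) auto
    then have "(x' - d') \<bullet> (- (\<mu> *\<^sub>R x')) \<le> - s * (norm (- (\<mu> *\<^sub>R x')))\<^sup>2"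
      by (simp only: norm_minus_cancel norm_scaleR power_mult_distrib power2_abs power2_norm_eq_inner)
         (simp add: algebra_simps inner_commute power2_eq_square)
    moreover have "0 < (norm (- (\<mu> *\<^sub>R x')))\<^sup>2"
      using x' \<mu> by simp
    ultimately show ?thesis
      by (simp only: ereal_less_eq pos_divide_le_eq)
  qed
  finally show False using tau by simp
qed

section \<open>The Moreau envelope\<close>

definition env :: "'a \<Rightarrow> real" where
  "env q = val (prox q) + (norm (prox q - q))\<^sup>2 / (2 * \<mu>)"

text \<open>The minimizer for \<open>q\<close> is a competitor for \<open>q'\<close>.\<close>

lemma env_le_quadratic: "env q' \<le> env q + grad q \<bullet> (q' - q) + (norm (q' - q))\<^sup>2 / (2 * \<mu>)"
proof -
  have "env q' \<le> val (prox q) + (norm (prox q - q'))\<^sup>2 / (2 * \<mu>)"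
    unfolding env_def using prox_le[OF prox_minimizes(1) prox_finite] .
  also have "(norm (prox q - q'))\<^sup>2
      = (norm (prox q - q))\<^sup>2 + 2 * ((q - prox q) \<bullet> (q' - q)) + (norm (q' - q))\<^sup>2"
    by (simp only: power2_norm_eq_inner) (simp add: algebra_simps inner_commute)
  also have "\<dots> / (2 * \<mu>) = (norm (prox q - q))\<^sup>2 / (2 * \<mu>) + grad q \<bullet> (q' - q) + (norm (q' - q))\<^sup>2 / (2 * \<mu>)"
    using \<mu> by (simp add: grad_def add_divide_distrib)
  finally show ?thesis by (simp add: env_def)
qed

text \<open>Exchanging the roles of \<open>q\<close> and \<open>q'\<close> in the upper estimate gives a lower estimate with
  \<open>grad q'\<close>, which the Lipschitz bound replaces by \<open>grad q\<close>.\<close>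

lemma env_quadratic_error:
  assumes "q \<in> ball qbar \<delta>"
  shows "\<bar>env q' - env q - grad q \<bullet> (q' - q)\<bar> \<le> (3 / (c * \<mu>) + 1 / (2 * \<mu>)) * (norm (q' - q))\<^sup>2"
proof -
  have "\<bar>(grad q' - grad q) \<bullet> (q' - q)\<bar> \<le> norm (grad q' - grad q) * norm (q' - q)"
    by (rule Cauchy_Schwarz_ineq2)
  also have "\<dots> \<le> 3 / (c * \<mu>) * norm (q' - q) * norm (q' - q)"
    by (intro mult_right_mono grad_lipschitz assms) auto
  finally have "\<bar>(grad q' - grad q) \<bullet> (q' - q)\<bar> \<le> 3 / (c * \<mu>) * (norm (q' - q))\<^sup>2"
    by (simp add: power2_eq_square)
  moreover have "(grad q' - grad q) \<bullet> (q' - q) = - (grad q' \<bullet> (q - q')) - grad q \<bullet> (q' - q)"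
    by (simp add: algebra_simps)
  moreover have "0 \<le> 3 / (c * \<mu>) * (norm (q' - q))\<^sup>2"
    using c \<mu> by simp
  ultimately show ?thesis
    using env_le_quadratic[of q' q] env_le_quadratic[of q q']
    by (simp add: norm_minus_commute[of q q'] distrib_right abs_le_iff)
qed

lemma env_has_derivative_along_line:
  assumes "q + t *\<^sub>R h \<in> ball qbar \<delta>"
  shows "((\<lambda>t. env (q + t *\<^sub>R h)) has_real_derivative grad (q + t *\<^sub>R h) \<bullet> h) (at t)"
proof (rule has_real_derivative_of_quadratic_error, intro always_eventually allI)
  fix s
  have "q + s *\<^sub>R h - (q + t *\<^sub>R h) = (s - t) *\<^sub>R h"
    by (simp add: algebra_simps)
  then show "\<bar>env (q + s *\<^sub>R h) - env (q + t *\<^sub>R h) - grad (q + t *\<^sub>R h) \<bullet> h * (s - t)\<bar>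
      \<le> (3 / (c * \<mu>) + 1 / (2 * \<mu>)) * (norm h)\<^sup>2 * (s - t)\<^sup>2"
    using env_quadratic_error[OF assms, of "q + s *\<^sub>R h"]
    by (simp add: power_mult_distrib mult.commute mult.left_commute)
qed

text \<open>Because \<open>grad = (id - prox) / \<mu>\<close>, an upper bound on the expansion of \<open>prox\<close> is a lower
  bound on the monotonicity of \<open>grad\<close>; integration along the segment turns it into a bound on
  the envelope.\<close>

lemma prox_expansion_imp_env_lower_bound:
  assumes e: "e \<le> \<delta>"
    and expand: "\<And>a b. a \<in> ball qbar e \<Longrightarrow> b \<in> ball qbar e \<Longrightarrow>
      (prox a - prox b) \<bullet> (a - b) \<le> L * (norm (a - b))\<^sup>2"
    and q: "q \<in> ball qbar e" "q' \<in> ball qbar e"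
  shows "env q + grad q \<bullet> (q' - q) - (L - 1) / (2 * \<mu>) * (norm (q' - q))\<^sup>2 \<le> env q'"
proof -
  define h where "h = q' - q"
  define k where "k = (L - 1) / \<mu> * (norm h)\<^sup>2"
  \<comment> \<open>The bound to be proved is \<open>?F 0 \<le> ?F 1\<close>.\<close>
  let ?F = "\<lambda>t. env (q + t *\<^sub>R h) - t * (grad q \<bullet> h) + k / 2 * t\<^sup>2"
  have "?F 0 \<le> ?F 1"
  proof (rule DERIV_nonneg_imp_nondecreasing[where f = ?F])
    fix t :: real assume t: "0 \<le> t" "t \<le> 1"
    have "q + t *\<^sub>R h = (1 - t) *\<^sub>R q + t *\<^sub>R q'"
      by (simp add: h_def algebra_simps)
    also have "\<dots> \<in> ball qbar e"
      using t q by (intro convexD[OF convex_ball]) auto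
    finally have qt: "q + t *\<^sub>R h \<in> ball qbar e" .
    have "q + t *\<^sub>R h \<in> ball qbar \<delta>"
      using qt e by simp
    then have "(?F has_real_derivative grad (q + t *\<^sub>R h) \<bullet> h - 1 * (grad q \<bullet> h) + k / 2 * (2 * t)) (at t)"
      by (auto intro!: derivative_eq_intros env_has_derivative_along_line)
    moreover have "0 \<le> grad (q + t *\<^sub>R h) \<bullet> h - 1 * (grad q \<bullet> h) + k / 2 * (2 * t)"
    proof (cases "t = 0")
      case False
      then have t0: "0 < t" using t by simp
      have "(prox (q + t *\<^sub>R h) - prox q) \<bullet> (t *\<^sub>R h) \<le> L * (norm (t *\<^sub>R h))\<^sup>2"
        using expand[OF qt q(1)] by simp
      then have "t * ((prox (q + t *\<^sub>R h) - prox q) \<bullet> h) \<le> t * (L * t * (norm h)\<^sup>2)"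
        by (simp add: power_mult_distrib power2_eq_square mult_ac)
      then have "(prox (q + t *\<^sub>R h) - prox q) \<bullet> h \<le> L * t * (norm h)\<^sup>2"
        using t0 by simp
      moreover have "(grad (q + t *\<^sub>R h) - grad q) \<bullet> h
          = (t * (norm h)\<^sup>2 - (prox (q + t *\<^sub>R h) - prox q) \<bullet> h) / \<mu>"
        using \<mu> by (simp add: grad_def power2_norm_eq_inner field_simps)
          (simp add: algebra_simps)
      ultimately have "(t * (norm h)\<^sup>2 - L * t * (norm h)\<^sup>2) / \<mu> \<le> (grad (q + t *\<^sub>R h) - grad q) \<bullet> h"
        using \<mu> by (simp add: divide_right_mono)
      moreover have "(t * (norm h)\<^sup>2 - L * t * (norm h)\<^sup>2) / \<mu> = - (k * t)"
        using \<mu> by (simp add: k_def field_simps)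
      ultimately show ?thesis
        by (simp add: inner_diff_left)
    qed simp
    ultimately show "\<exists>y. (?F has_real_derivative y) (at t) \<and> 0 \<le> y" by blast
  qed simp
  then show ?thesis
    by (simp add: h_def k_def)
qed

text \<open>
  For \<open>(u, v) \<in> T\<close> and \<open>q = u + \<mu> *\<^sub>R v\<close>, the value of \<open>g\<close> at \<open>u\<close> is read off from \<open>env q\<close>,
  while \<open>g x\<close> is bounded below by \<open>env q' - (norm (x - q'))\<^sup>2 / (2 * \<mu>)\<close> for every \<open>q'\<close>.
  Among the points \<open>q' = q + k *\<^sub>R (x - u)\<close> the choice \<open>k = 1 - s * \<mu>\<close> maximizes the resulting
  lower bound and produces the constant \<open>s\<close> without loss.
\<close>

lemma prox_expansion_imp_prox_inequality:
  assumes s: "0 < s" "s * \<mu> < 1" and e: "0 < e" "e \<le> \<delta>"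
    and expand: "\<And>a b. a \<in> ball qbar e \<Longrightarrow> b \<in> ball qbar e \<Longrightarrow>
      (prox a - prox b) \<bullet> (a - b) \<le> 1 / (1 - s * \<mu>) * (norm (a - b))\<^sup>2"
  shows "\<exists>\<rho>'>0. prox_inequality_near s \<rho>' g xbar vhat"
proof -
  define k where "k = 1 - s * \<mu>"
  have k: "0 < k" "k < 1" using s \<mu> by (auto simp: k_def)
  define \<rho>' where "\<rho>' = min \<rho> (e / (2 * (3 + \<mu>)))"
  have \<rho>': "0 < \<rho>'" "\<rho>' \<le> \<rho>" "\<rho>' * (3 + \<mu>) < e"
  proof -
    have "\<rho>' * (3 + \<mu>) \<le> e / (2 * (3 + \<mu>)) * (3 + \<mu>)"
      using \<mu> by (intro mult_right_mono) (auto simp: \<rho>'_def)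
    also have "\<dots> = e / 2"
      using \<mu> by (simp add: field_simps)
    finally show "\<rho>' * (3 + \<mu>) < e" using e by simp
  qed (use \<rho> e \<mu> in \<open>auto simp: \<rho>'_def\<close>)
  have "g u + ereal (v \<bullet> (x - u) - s / 2 * (norm (x - u))\<^sup>2) \<le> g x"
    if u: "u \<in> cball xbar \<rho>'" and v: "v \<in> limiting_subdifferential g u" "v \<in> cball vhat \<rho>'"
      and x: "x \<in> cball xbar \<rho>'" for u v x
  proof (cases "g x = \<infinity>")
    case False
    then have finx: "\<bar>g x\<bar> \<noteq> \<infinity>" using not_MInf[of x] by auto
    have uv: "(u, v) \<in> T" "u \<in> cball xbar \<rho>" "v \<in> cball vhat \<rho>"
      using u v \<rho>' by auto
    let ?d = "x - u"
    define q where "q = u + \<mu> *\<^sub>R v"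
    define q' where "q' = q + k *\<^sub>R ?d"
    have q_eq: "prox q = u" "grad q = v"
      using prox_eq[OF uv] by (auto simp: q_def)
    have dq: "norm (q - qbar) \<le> \<rho>' + \<mu> * \<rho>'"
    proof -
      have "q - qbar = (u - xbar) + \<mu> *\<^sub>R (v - vhat)"
        by (simp add: q_def qbar_def algebra_simps)
      then have "norm (q - qbar) \<le> norm (u - xbar) + \<mu> * norm (v - vhat)"
        using norm_triangle_ineq[of "u - xbar" "\<mu> *\<^sub>R (v - vhat)"] \<mu> by simp
      also have "\<dots> \<le> \<rho>' + \<mu> * \<rho>'"
        using u v \<mu> by (intro add_mono mult_left_mono) (auto simp: dist_norm norm_minus_commute)
      finally show ?thesis .
    qed
    have dd: "norm ?d \<le> 2 * \<rho>'"
      using u x norm_triangle_ineq4[of "x - xbar" "u - xbar"]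
      by (simp add: dist_norm norm_minus_commute)
    have "norm (q' - qbar) \<le> norm (q - qbar) + k * norm ?d"
      using norm_triangle_ineq[of "q - qbar" "k *\<^sub>R ?d"] k
      by (simp add: q'_def add.commute add_diff_eq)
    also have "\<dots> \<le> \<rho>' + \<mu> * \<rho>' + 1 * (2 * \<rho>')"
      using dq dd k by (intro add_mono mult_mono) auto
    finally have q'e: "q' \<in> ball qbar e"
      using \<rho>' by (simp add: dist_norm norm_minus_commute algebra_simps)
    have qe: "q \<in> ball qbar e"
      using dq \<rho>' by (simp add: dist_norm norm_minus_commute algebra_simps)
    have "env q + grad q \<bullet> (q' - q) - (1 / k - 1) / (2 * \<mu>) * (norm (q' - q))\<^sup>2 \<le> env q'"
      by (rule prox_expansion_imp_env_lower_bound[OF e(2) _ qe q'e])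
         (use expand in \<open>simp add: k_def\<close>)
    also have "env q' \<le> val x + (norm (x - q'))\<^sup>2 / (2 * \<mu>)"
      unfolding env_def using x \<rho>' by (intro prox_le finx) auto
    finally have main: "env q + grad q \<bullet> (q' - q) - (1 / k - 1) / (2 * \<mu>) * (norm (q' - q))\<^sup>2
        \<le> val x + (norm (x - q'))\<^sup>2 / (2 * \<mu>)" .
    have env_q: "env q = val u + \<mu> / 2 * (norm v)\<^sup>2"
      unfolding env_def q_eq using \<mu> by (simp add: q_def power_mult_distrib power2_eq_square)
    have t1: "grad q \<bullet> (q' - q) = k * (v \<bullet> ?d)"
      by (simp add: q_eq q'_def)
    have t2: "(1 / k - 1) / (2 * \<mu>) * (norm (q' - q))\<^sup>2 = s * k / 2 * (norm ?d)\<^sup>2"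
    proof -
      have "(1 / k - 1) * k = s * \<mu>"
        using k by (simp add: k_def algebra_simps)
      then have coeff: "(1 / k - 1) / (2 * \<mu>) * k\<^sup>2 = s * k / 2"
        using \<mu> by (simp add: power2_eq_square field_simps)
      have "(norm (q' - q))\<^sup>2 = k\<^sup>2 * (norm ?d)\<^sup>2"
        by (simp add: q'_def power_mult_distrib)
      then show ?thesis
        by (simp only: coeff flip: mult.assoc)
    qed
    have t3: "(norm (x - q'))\<^sup>2 / (2 * \<mu>)
        = s\<^sup>2 * \<mu> / 2 * (norm ?d)\<^sup>2 - s * \<mu> * (v \<bullet> ?d) + \<mu> / 2 * (norm v)\<^sup>2"
    proof -
      have "x - q' = \<mu> *\<^sub>R (s *\<^sub>R ?d - v)"
        by (simp add: q'_def q_def k_def algebra_simps)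
      then have "(norm (x - q'))\<^sup>2 / (2 * \<mu>) = \<mu> / 2 * (norm (s *\<^sub>R ?d - v))\<^sup>2"
        using \<mu> by (simp add: power_mult_distrib power2_eq_square)
      also have "(norm (s *\<^sub>R ?d - v))\<^sup>2 = s\<^sup>2 * (norm ?d)\<^sup>2 - 2 * s * (v \<bullet> ?d) + (norm v)\<^sup>2"
        by (simp only: power2_norm_eq_inner)
           (simp add: inner_diff_left inner_diff_right inner_commute power2_eq_square algebra_simps)
      finally show ?thesis by (simp add: algebra_simps)
    qed
    have "val u + (k + s * \<mu>) * (v \<bullet> ?d) - (s * (k + s * \<mu>) / 2) * (norm ?d)\<^sup>2 \<le> val x"
      using main unfolding env_q t1 t2 t3
      by (simp add: algebra_simps power2_eq_square add_divide_distrib)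
    then have "val u + v \<bullet> ?d - s / 2 * (norm ?d)\<^sup>2 \<le> val x"
      by (simp add: k_def)
    then show ?thesis
      using val[OF finx] val[OF T_finite[OF uv(1)]] by simp
  qed simp
  then show ?thesis
    using \<rho>'(1) unfolding prox_inequality_near_def by blast
qed

lemma tau0_imp_prox_inequality:
  assumes "0 < s" "s * \<mu> < 1" "ereal (- s) < tau0 g xbar vhat"
  shows "\<exists>\<rho>'>0. prox_inequality_near s \<rho>' g xbar vhat"
  using tau0_controls_prox_expansion[OF assms] prox_expansion_imp_prox_inequality[OF assms(1,2)]
  by blast

end

section \<open>The threshold of prox-regularity\<close>

text \<open>Subdifferential continuity keeps \<open>g u \<le> g xbar + \<epsilon>\<close> for all \<open>(u, v)\<close> in the graph close
  to \<open>(xbar, vhat)\<close>, so the restriction on function values can be absorbed into the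
  neighbourhoods.\<close>

lemma prox_regular_with_iff_near:
  fixes g :: "'a::euclidean_space \<Rightarrow> ereal"
  assumes base: "vhat \<in> limiting_subdifferential g xbar"
    and cont: "subdifferentially_continuous g xbar vhat"
  shows "prox_regular_with r g xbar vhat \<longleftrightarrow> (\<exists>\<rho>>0. prox_inequality_near r \<rho> g xbar vhat)"
proof
  assume "prox_regular_with r g xbar vhat"
  then obtain U V \<epsilon> where U: "open U" "xbar \<in> U" and V: "open V" "vhat \<in> V" and \<epsilon>: "0 < (\<epsilon>::real)"
    and ineq: "\<And>u v x. u \<in> U \<Longrightarrow> g u \<le> g xbar + ereal \<epsilon> \<Longrightarrow>
      v \<in> limiting_subdifferential g u \<Longrightarrow> v \<in> V \<Longrightarrow> x \<in> U \<Longrightarrow>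
      g u + ereal (v \<bullet> (x - u) - r / 2 * (norm (x - u))\<^sup>2) \<le> g x"
    unfolding prox_regular_with_def by blast
  let ?T = "graph_of (limiting_subdifferential g)"
  have fin: "\<bar>g xbar\<bar> \<noteq> \<infinity>"
    using base by (rule limiting_subdifferential_finite)
  have less: "g xbar < g xbar + ereal \<epsilon>"
    using fin \<epsilon> by (cases "g xbar") auto
  have "((\<lambda>(x, v). g x) \<longlongrightarrow> g xbar) (at (xbar, vhat) within ?T)"
    using cont by (simp add: subdifferentially_continuous_def continuous_within)
  then have "\<forall>\<^sub>F y in at (xbar, vhat) within ?T. (case y of (x, v) \<Rightarrow> g x) < g xbar + ereal \<epsilon>"
    using less by (rule order_tendstoD)
  then obtain d where d: "0 < d" and near: "\<And>y. y \<in> ?T \<Longrightarrow> y \<noteq> (xbar, vhat) \<Longrightarrow>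
      dist y (xbar, vhat) < d \<Longrightarrow> g (fst y) < g xbar + ereal \<epsilon>"
    unfolding eventually_at case_prod_beta by blast
  obtain a where a: "0 < a" "cball xbar a \<subseteq> U"
    using U open_contains_cball by blast
  obtain b where b: "0 < b" "cball vhat b \<subseteq> V"
    using V open_contains_cball by blast
  define \<rho> where "\<rho> = min (d / 3) (min a b)"
  have \<rho>: "0 < \<rho>" "\<rho> \<le> d / 3" "\<rho> \<le> a" "\<rho> \<le> b"
    using d a b by (auto simp: \<rho>_def)
  have "g u + ereal (v \<bullet> (x - u) - r / 2 * (norm (x - u))\<^sup>2) \<le> g x"
    if u: "u \<in> cball xbar \<rho>" and v: "v \<in> limiting_subdifferential g u" "v \<in> cball vhat \<rho>"
      and x: "x \<in> cball xbar \<rho>" for u v x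
  proof (rule ineq)
    show "u \<in> U" "v \<in> V" "x \<in> U"
      using u v x \<rho> a b by auto
    have "dist (u, v) (xbar, vhat) \<le> norm (u - xbar) + norm (v - vhat)"
      using norm_Pair_le[of "u - xbar" "v - vhat"] by (simp add: dist_norm)
    also have "\<dots> < d"
      using u v \<rho> d by (simp add: dist_norm norm_minus_commute)
    finally have dist: "dist (u, v) (xbar, vhat) < d" .
    show "g u \<le> g xbar + ereal \<epsilon>"
    proof (cases "(u, v) = (xbar, vhat)")
      case True
      then show ?thesis using less by simp
    next
      case False
      then show ?thesis
        using near[of "(u, v)"] dist v by (simp add: graph_of_def less_imp_le)
    qed
  qed (rule v)
  then show "\<exists>\<rho>>0. prox_inequality_near r \<rho> g xbar vhat"
    using \<rho>(1) unfolding prox_inequality_near_def by blast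
next
  assume "\<exists>\<rho>>0. prox_inequality_near r \<rho> g xbar vhat"
  then obtain \<rho> where "0 < \<rho>" and ineq: "prox_inequality_near r \<rho> g xbar vhat" by blast
  have "\<forall>u v x. u \<in> ball xbar \<rho> \<and> g u \<le> g xbar + ereal 1 \<and>
      v \<in> limiting_subdifferential g u \<inter> ball vhat \<rho> \<and> x \<in> ball xbar \<rho> \<longrightarrow>
      g u + ereal (v \<bullet> (x - u) - r / 2 * (norm (x - u))\<^sup>2) \<le> g x"
    using ineq unfolding prox_inequality_near_def by (meson IntD1 IntD2 ball_subset_cball subsetD)
  with \<open>0 < \<rho>\<close> show "prox_regular_with r g xbar vhat"
    unfolding prox_regular_with_def
    by (intro exI[where x = "ball xbar \<rho>"] exI[where x = "ball vhat \<rho>"] exI[where x = 1]) auto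
qed

theorem theorem5p4:
  fixes g :: "'a::euclidean_space \<Rightarrow> ereal" and xbar vhat :: 'a
  assumes "\<And>x. g x \<noteq> -\<infinity>"
    and "lower_semicontinuous g"
    and "vhat \<in> limiting_subdifferential g xbar"
    and "prox_regular g xbar vhat"
    and "subdifferentially_continuous g xbar vhat"
  shows "tau0 g xbar vhat > -\<infinity> \<and>
         prox_regularity_threshold g xbar vhat = max 0 (- tau0 g xbar vhat)"
proof -
  have localize: "\<exists>\<rho>. proximal_localization g xbar vhat r \<mu> \<rho>"
    if "0 < r" "prox_regular_with r g xbar vhat" "0 < \<mu>" "r * \<mu> < 1" for r \<mu>
    using that assms prox_regular_with_iff_near[OF assms(3,5)]
    by (auto simp: proximal_localization_def)
  have lower: "ereal (- r) \<le> tau0 g xbar vhat" if r: "0 < r" "prox_regular_with r g xbar vhat" for r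
  proof -
    obtain \<rho> where "proximal_localization g xbar vhat r (1 / (2 * r)) \<rho>"
      using localize[OF r, of "1 / (2 * r)"] r by auto
    then show ?thesis by (rule proximal_localization.tau0_lower_bound)
  qed
  obtain r0 where r0: "0 < r0" "prox_regular_with r0 g xbar vhat"
    using assms(4) by (auto simp: prox_regular_def)
  have upper: "prox_regular_with s g xbar vhat" if s: "0 < s" "ereal (- s) < tau0 g xbar vhat" for s
  proof -
    let ?\<mu> = "1 / (r0 + s)"
    obtain \<rho> where "proximal_localization g xbar vhat r0 ?\<mu> \<rho>"
      using localize[OF r0, of ?\<mu>] r0 s by (auto simp: field_simps)
    then have "\<exists>\<rho>'>0. prox_inequality_near s \<rho>' g xbar vhat"
      by (rule proximal_localization.tau0_imp_prox_inequality) (use r0 s in \<open>auto simp: field_simps\<close>)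
    then show ?thesis
      using prox_regular_with_iff_near[OF assms(3,5)] by simp
  qed
  show ?thesis
  proof
    show "tau0 g xbar vhat > -\<infinity>"
      using lower[OF r0] by (cases "tau0 g xbar vhat") auto
    show "prox_regularity_threshold g xbar vhat = max 0 (- tau0 g xbar vhat)"
      unfolding prox_regularity_threshold_def
    proof (rule antisym)
      show "max 0 (- tau0 g xbar vhat) \<le> Inf {ereal r |r. 0 < r \<and> prox_regular_with r g xbar vhat}"
        using lower by (auto intro!: Inf_greatest simp: ereal_uminus_le_reorder)
      show "Inf {ereal r |r. 0 < r \<and> prox_regular_with r g xbar vhat} \<le> max 0 (- tau0 g xbar vhat)"
      proof (rule dense_ge)
        fix y assume y: "max 0 (- tau0 g xbar vhat) < y"
        show "Inf {ereal r |r. 0 < r \<and> prox_regular_with r g xbar vhat} \<le> y"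
        proof (cases y)
          case (real s)
          then have "0 < s" "ereal (- s) < tau0 g xbar vhat"
            using y by (auto simp: ereal_uminus_less_reorder)
          then show ?thesis
            unfolding real by (intro Inf_lower) (auto intro: upper)
        qed (use y in auto)
      qed
    qed
  qed
qed

end
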